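(* Consider a sequence, indexed by $N\geq 1$, of Biorthogonal Ensembles satisfying the structural assumption (both described in the context). Assume there exists $\varepsilon>0$ such that for every integer $n\geq 1$, $$\max_{k,m\in\mathbb N:\ \left|\frac kN-1\right|\leq\varepsilon,\ \left|\frac mN-1\right|\leq\varepsilon}\left|\langle xP_{k,N},Q_{m,N}\rangle_{L^2(\mu_N)}\right|=o(N^{1/n})\qquad\text{as }N\to\infty .$$ If (a) for all $N$ large enough $\chi_N$ has only real zeros, and (b) there exists a probability measure $\mu^*$ on $\mathbb R$ characterized by its moments such that for all $\ell\in\mathbb N$, $$\lim_{N\to\infty}\mathbb E\left[\int x^\ell\,\hat\mu^N(\mathrm dx)\right]=\int x^\ell\,\mu^*(\mathrm dx),$$ then $\nu_N$ converges weakly towards $\mu^*$ as $N\to\infty$.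
   Context: $\mathbb N=\{0,1,2,\dots\}$. All functions are real-valued and $\langle f,g\rangle_{L^2(\mu)}=\int fg\,\mathrm d\mu$. Biorthogonal Ensemble: for each $N\ge1$ let $\mu_N$ be a Borel measure on $\mathbb R$ and $(P_{k,N})_{k=0}^{N-1}$, $(Q_{k,N})_{k=0}^{N-1}$ two families in $L^2(\mu_N)$ with $\langle P_{k,N},Q_{m,N}\rangle_{L^2(\mu_N)}=\delta_{km}$ for $0\le k,m\le N-1$, such that $$\frac1{N!}\det\big[P_{k-1,N}(x_i)\big]_{i,k=1}^N\det\big[Q_{k-1,N}(x_i)\big]_{i,k=1}^N\prod_{i=1}^N\mu_N(\mathrm dx_i)$$ is a probability measure on $\mathbb R^N$. The real random variables $x_1,\dots,x_N$ (depending on $N$) have this joint distribution; $\mathbb E$ denotes the corresponding expectation. Structural assumption: (a) for each $N$, the two families can be completed into infinite families $(P_{k,N})_{k\in\mathbb N}$, $(Q_{k,N})_{k\in\mathbb N}$ of $L^2(\mu_N)$ with $\langle P_{k,N},Q_{m,N}\rangle_{L^2(\mu_N)}=\delta_{km}$ for all $k,m\in\mathbb N$ (these completed families are fixed); (b) there is a sequence $(\mathfrak q_N)_{N\ge1}$ of nonnegative integers such that for every integer $n\ge1$, $\mathfrak q_N=o(N^{1/n})$ as $N\to\infty$, and for all $N\ge 1$, $k\in\mathbb N$, the function $x\mapsto xP_{k,N}(x)$ belongs to $\mathrm{Span}(P_{m,N})_{m=0}^{k+\mathfrak q_N}$. Empirical measure: $\hat\mu^N=\frac1N\sum_{i=1}^N\delta_{x_i}$.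 Average characteristic polynomial: $\chi_N(z)=\mathbb E\big[\prod_{i=1}^N(z-x_i)\big]$, $z\in\mathbb C$, a monic polynomial of degree $N$. Its complex zeros counted with multiplicity are $z_1,\dots,z_N$, and $\nu_N=\frac1N\sum_{i=1}^N\delta_{z_i}$. A probability measure on $\mathbb R$ is characterized by its moments if all its moments are finite and it is the only probability measure on $\mathbb R$ with these moments. *)

theory Defs
  imports
    "HOL-Probability.Probability"
    "HOL-Computational_Algebra.Computational_Algebra"
    "HOL-Library.Landau_Symbols"
    "Jordan_Normal_Form.Determinant"
begin

definition in_L2 :: "real measure \<Rightarrow> (real \<Rightarrow> real) \<Rightarrow> bool" where
  "in_L2 M f \<longleftrightarrow> f \<in> borel_measurable M \<and> integrable M (\<lambda>x. (f x)\<^sup>2)"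

definition L2_inner :: "real measure \<Rightarrow> (real \<Rightarrow> real) \<Rightarrow> (real \<Rightarrow> real) \<Rightarrow> real" where
  "L2_inner M f g = (\<integral>x. f x * g x \<partial>M)"

(* The variables x_1, ..., x_N are indexed by {..<N}: a point of R^N is an element of
   the space of PiM {..<N}. *)

definition be_weight ::
    "nat \<Rightarrow> (nat \<Rightarrow> real \<Rightarrow> real) \<Rightarrow> (nat \<Rightarrow> real \<Rightarrow> real) \<Rightarrow> (nat \<Rightarrow> real) \<Rightarrow> real" where
  "be_weight N P Q x = 1 / fact N
     * Determinant.det (Matrix.mat N N (\<lambda>(i, k). P k (x i)))
     * Determinant.det (Matrix.mat N N (\<lambda>(i, k). Q k (x i)))"

definition be_law ::
    "nat \<Rightarrow> real measure \<Rightarrow> (nat \<Rightarrow> real \<Rightarrow> real) \<Rightarrow> (nat \<Rightarrow> real \<Rightarrow> real)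
      \<Rightarrow> (nat \<Rightarrow> real) measure" where
  "be_law N M P Q = density (PiM {..<N} (\<lambda>_. M)) (\<lambda>x. ennreal (be_weight N P Q x))"

(* Since ennreal truncates negative reals to 0, nonnegativity of the weight is required
   explicitly besides total mass 1. *)
definition biorthogonal_ensemble ::
    "nat \<Rightarrow> real measure \<Rightarrow> (nat \<Rightarrow> real \<Rightarrow> real) \<Rightarrow> (nat \<Rightarrow> real \<Rightarrow> real) \<Rightarrow> bool" where
  "biorthogonal_ensemble N M P Q \<longleftrightarrow>
     sets M = sets borel \<and>
     (\<forall>k<N. in_L2 M (P k) \<and> in_L2 M (Q k)) \<and>
     (\<forall>k<N. \<forall>m<N. L2_inner M (P k) (Q m) = (if k = m then 1 else 0)) \<and>
     (AE x in PiM {..<N} (\<lambda>_. M). be_weight N P Q x \<ge> 0) \<and>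
     prob_space (be_law N M P Q)"

(* Membership in the span is meant in L^2(M N), hence almost everywhere. *)
definition structural_assumption ::
    "(nat \<Rightarrow> real measure) \<Rightarrow> (nat \<Rightarrow> nat \<Rightarrow> real \<Rightarrow> real) \<Rightarrow> (nat \<Rightarrow> nat \<Rightarrow> real \<Rightarrow> real)
      \<Rightarrow> bool" where
  "structural_assumption M P Q \<longleftrightarrow>
     (\<forall>N\<ge>1. (\<forall>k. in_L2 (M N) (P N k) \<and> in_L2 (M N) (Q N k)) \<and>
        (\<forall>k m. L2_inner (M N) (P N k) (Q N m) = (if k = m then 1 else 0))) \<and>
     (\<exists>q :: nat \<Rightarrow> nat.
        (\<forall>n::nat. n \<ge> 1 \<longrightarrow> (\<lambda>N. real (q N)) \<in> o(\<lambda>N. real N powr (1 / real n))) \<and>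
        (\<forall>N\<ge>1. \<forall>k. \<exists>c :: nat \<Rightarrow> real.
           AE x in M N. x * P N k x = (\<Sum>m\<le>k + q N. c m * P N m x)))"

(* For a nonempty multiset X: (1 / size X) times the sum of the Dirac masses at the elements
   of X, counted with multiplicity. *)
definition empirical_measure :: "'a::topological_space multiset \<Rightarrow> 'a measure" where
  "empirical_measure X = distr (measure_pmf (pmf_of_multiset X)) borel (\<lambda>x. x)"

definition empirical_points :: "nat \<Rightarrow> (nat \<Rightarrow> real) \<Rightarrow> real measure" where
  "empirical_points N x = empirical_measure (image_mset x (mset_set {..<N}))"

definition avg_char :: "nat \<Rightarrow> (nat \<Rightarrow> real) measure \<Rightarrow> complex \<Rightarrow> complex" where
  "avg_char N L z = (\<integral>x. (\<Prod>i<N. (z - complex_of_real (x i))) \<partial>L)"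

(* The polynomial defining the function avg_char; it is unique, since the field is infinite. *)
definition avg_char_poly :: "nat \<Rightarrow> (nat \<Rightarrow> real) measure \<Rightarrow> complex poly" where
  "avg_char_poly N L = (THE p. \<forall>z. poly p z = avg_char N L z)"

definition zeros_distribution :: "nat \<Rightarrow> (nat \<Rightarrow> real) measure \<Rightarrow> complex measure" where
  "zeros_distribution N L = empirical_measure (proots (avg_char_poly N L))"

definition characterized_by_moments :: "real measure \<Rightarrow> bool" where
  "characterized_by_moments M \<longleftrightarrow>
     real_distribution M \<and> (\<forall>l::nat. integrable M (\<lambda>x. x ^ l)) \<and>
     (\<forall>M'. real_distribution M' \<and> (\<forall>l::nat. integrable M' (\<lambda>x. x ^ l)) \<and>
        (\<forall>l::nat. (\<integral>x. x ^ l \<partial>M') = (\<integral>x. x ^ l \<partial>M)) \<longrightarrow> M' = M)"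

(* HOL-Probability's weak_conv_m only covers measures on the real line, via distribution
   functions; the zeros are a priori complex. *)
definition weakly_converges :: "(nat \<Rightarrow> 'a::topological_space measure) \<Rightarrow> 'a measure \<Rightarrow> bool" where
  "weakly_converges M M' \<longleftrightarrow>
     (\<forall>f :: 'a \<Rightarrow> real. continuous_on UNIV f \<and> bounded (range f) \<longrightarrow>
        (\<lambda>n. \<integral>x. f x \<partial>M n) \<longlonglongrightarrow> (\<integral>x. f x \<partial>M'))"

end

theory Submission
  imports Defs "Jordan_Normal_Form.Schur_Decomposition"
begin

text \<open>
  Write \<open>J k m\<close> for the scalar product of \<open>x P k\<close> and \<open>Q m\<close>, at fixed \<open>N\<close>. This is the matrix of
  multiplication by \<open>x\<close> in the biorthogonal basis. The proof compares two sequences of moments.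

  The first is the expected moments of the random points. Since the weight of the ensemble is a
  product of two determinants, Andreief's identity shows that the expectation of
  \<open>\<Sum>i<N. x i ^ l\<close> is the trace over the first \<open>N\<close> indices of the \<open>l\<close>-th power of the infinite
  matrix \<open>J\<close> (\<open>expected_empirical_moment\<close>). The second is the moments of the zeros. The same identity
  shows that the average characteristic polynomial is the characteristic polynomial of the truncated
  \<open>N\<close> by \<open>N\<close> matrix, so the sum of the \<open>l\<close>-th powers of its zeros is the trace of the \<open>l\<close>-th
  power of the truncation (\<open>zeros_of_avg_char\<close>).

  The two traces differ only by the closed walks of \<open>l\<close> steps that start below \<open>N\<close> and visit an index
  at or above \<open>N\<close>. As a step of nonzero weight increases the index by at most \<open>q N\<close>, such walks stay
  within a distance \<open>O(q N)\<close> of \<open>N\<close>, and there the entries of \<open>J\<close> are smaller than every positive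
  power of \<open>N\<close>. There are \<open>O((q N + 1) ^ l)\<close> of them, so their total weight is \<open>o(N)\<close>
  (\<open>trace_truncation_error\<close>, \<open>walk_sum_difference_negligible\<close>). Dividing by \<open>N\<close>, the moments of the
  zeros converge to those of the limiting measure. Because the zeros are eventually real, the
  classical method of moments on the line (\<open>method_of_moments\<close>) turns this into weak convergence.

  Andreief's identity rests on Fubini's theorem and hence on sigma-finiteness of the reference
  measure, which is gained by restricting the measure to the set where some \<open>P k\<close> is nonzero
  (\<open>sigma_finite_representative\<close>).
\<close>

section \<open>The method of moments\<close>

text \<open>Weak convergence says nothing about unbounded test functions such as powers, so powers are
  truncated: \<open>clip K x ^ l\<close> is bounded and continuous, and its mean distance to \<open>x ^ l\<close> is
  controlled by an even moment of higher order.\<close>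

definition clip :: "real \<Rightarrow> real \<Rightarrow> real" where
  "clip K x = max (- K) (min K x)"

lemma abs_clip_le:
  assumes "K \<ge> 0"
  shows "\<bar>clip K x\<bar> \<le> K" and "\<bar>clip K x\<bar> \<le> \<bar>x\<bar>"
  using assms by (auto simp: clip_def)

lemma isCont_clip_power: "isCont (\<lambda>x. clip K x ^ l) x"
  unfolding clip_def by (intro continuous_intros)

lemma clip_measurable [measurable]: "clip K \<in> borel_measurable borel"
  unfolding clip_def by measurable

lemma clip_power_error:
  assumes "K \<ge> 1"
  shows "\<bar>x ^ l - clip K x ^ l\<bar> \<le> 2 * x ^ (2 * l + 2) / K"
proof (cases "\<bar>x\<bar> \<le> K")
  case True
  then have "clip K x = x" by (auto simp: clip_def)
  moreover have "x ^ (2 * l + 2) \<ge> 0" by (rule zero_le_even_power) simp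
  ultimately show ?thesis using assms by simp
next
  case False
  then have x: "\<bar>x\<bar> > K" by simp
  have "\<bar>x ^ l - clip K x ^ l\<bar> \<le> \<bar>x\<bar> ^ l + \<bar>clip K x\<bar> ^ l"
    by (metis abs_triangle_ineq4 power_abs)
  also have "\<dots> \<le> 2 * \<bar>x\<bar> ^ l"
    using abs_clip_le(2)[of K x] assms by (simp add: power_mono)
  also have "\<bar>x\<bar> ^ l \<le> x ^ (2 * l + 2) / K"
  proof -
    have "\<bar>x\<bar> ^ l * K \<le> \<bar>x\<bar> ^ l * \<bar>x\<bar>" using x by (intro mult_left_mono) auto
    also have "\<dots> = \<bar>x\<bar> ^ (l + 1)" by simp
    also have "\<dots> \<le> \<bar>x\<bar> ^ (2 * l + 2)" using x assms by (intro power_increasing) auto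
    also have "\<dots> = x ^ (2 * l + 2)" by (simp add: power_even_abs)
    finally show ?thesis using assms by (simp add: field_simps)
  qed
  finally show ?thesis by simp
qed

lemma (in real_distribution) integrable_clip_power:
  assumes "K \<ge> 0"
  shows "integrable M (\<lambda>x. clip K x ^ l)"
proof (rule integrable_const_bound[where B="K ^ l"])
  show "AE x in M. norm (clip K x ^ l) \<le> K ^ l"
    using abs_clip_le(1)[OF assms] by (auto simp: power_abs intro!: power_mono)
qed auto

lemma (in real_distribution) integral_clip_power_error:
  assumes "K \<ge> 1" and "\<And>l. integrable M (\<lambda>x. x ^ l)"
  shows "\<bar>(\<integral>x. x ^ l \<partial>M) - (\<integral>x. clip K x ^ l \<partial>M)\<bar> \<le> 2 * (\<integral>x. x ^ (2 * l + 2) \<partial>M) / K"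
proof -
  have i: "integrable M (\<lambda>x. clip K x ^ l)" using assms by (intro integrable_clip_power) auto
  have "\<bar>(\<integral>x. x ^ l \<partial>M) - (\<integral>x. clip K x ^ l \<partial>M)\<bar> = \<bar>\<integral>x. x ^ l - clip K x ^ l \<partial>M\<bar>"
    using i assms(2) by simp
  also have "\<dots> \<le> (\<integral>x. \<bar>x ^ l - clip K x ^ l\<bar> \<partial>M)"
    by (rule integral_abs_bound)
  also have "\<dots> \<le> (\<integral>x. 2 * x ^ (2 * l + 2) / K \<partial>M)"
    using i assms(2)[of "2 * l + 2"] assms(2)[of l] clip_power_error[OF assms(1)]
    by (intro integral_mono) auto
  finally show ?thesis by simp
qed

lemma (in real_distribution) integral_even_clip_le:
  assumes "K \<ge> 0" "integrable M (\<lambda>x. x ^ (2 * l))"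
  shows "(\<integral>x. clip K x ^ (2 * l) \<partial>M) \<le> (\<integral>x. x ^ (2 * l) \<partial>M)"
proof (rule integral_mono)
  show "clip K x ^ (2 * l) \<le> x ^ (2 * l)" for x
    using power_mono[OF abs_clip_le(2)[OF assms(1)], of x "2 * l"] by (simp add: power_even_abs)
qed (use assms integrable_clip_power in auto)

text \<open>Even moments are monotone limits of truncated even moments. The latter pass to the weak limit
  and stay below the supremum of the moments along the sequence, so monotone convergence makes the
  even moments of the limit finite; they dominate all the others.\<close>

lemma weak_limit_integrable_power:
  fixes \<mu> :: "nat \<Rightarrow> real measure"
  assumes \<mu>: "\<And>n. real_distribution (\<mu> n)" and \<nu>: "real_distribution \<nu>"
    and int: "\<And>n l. integrable (\<mu> n) (\<lambda>x. x ^ l)"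
    and lim: "\<And>l. (\<lambda>n. \<integral>x. x ^ l \<partial>\<mu> n) \<longlonglongrightarrow> m l"
    and weak: "weak_conv_m \<mu> \<nu>"
  shows "integrable \<nu> (\<lambda>x. x ^ l)"
proof -
  interpret \<nu>: real_distribution \<nu> by fact
  obtain C where C: "\<And>n. norm (\<integral>x. x ^ (2 * l) \<partial>\<mu> n) \<le> C"
    using convergent_imp_Bseq[OF convergentI[OF lim[of "2 * l"]]] BseqE by blast
  define I where "I K = (\<integral>x. clip (real K) x ^ (2 * l) \<partial>\<nu>)" for K :: nat
  have mono_clip: "mono (\<lambda>K. clip (real K) x ^ (2 * l))" for x
  proof (rule monoI)
    fix K L :: nat assume "K \<le> L"
    then have "\<bar>clip (real K) x\<bar> \<le> \<bar>clip (real L) x\<bar>" by (auto simp: clip_def)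
    from power_mono[OF this, of "2 * l"]
    show "clip (real K) x ^ (2 * l) \<le> clip (real L) x ^ (2 * l)" by (simp add: power_even_abs)
  qed
  have "I K \<le> C" for K
  proof -
    have "(\<lambda>n. \<integral>x. clip (real K) x ^ (2 * l) \<partial>\<mu> n) \<longlonglongrightarrow> I K"
      unfolding I_def
      by (rule weak_conv_imp_integral_bdd_continuous_conv[OF \<mu> \<nu> weak isCont_clip_power, of _ _ "real K ^ (2 * l)"])
         (auto simp: power_abs intro!: power_mono abs_clip_le)
    moreover have "(\<integral>x. clip (real K) x ^ (2 * l) \<partial>\<mu> n) \<le> C" for n
      using real_distribution.integral_even_clip_le[OF \<mu>[of n], of "real K" l] int[of n "2 * l"] C[of n]
      by simp
    ultimately show ?thesis by (intro LIMSEQ_le_const2) auto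
  qed
  moreover have "incseq I"
    unfolding I_def using mono_clip
    by (intro monoI integral_mono \<nu>.integrable_clip_power) (auto dest: monoD)
  ultimately obtain L where "I \<longlonglongrightarrow> L" using incseq_convergent by blast
  have "integrable \<nu> (\<lambda>x. x ^ (2 * l))"
  proof (rule integral_monotone_convergence_nonneg[where f="\<lambda>K x. clip (real K) x ^ (2 * l)"])
    show "(\<lambda>K. \<integral>x. clip (real K) x ^ (2 * l) \<partial>\<nu>) \<longlonglongrightarrow> L" using \<open>I \<longlonglongrightarrow> L\<close> by (simp add: I_def[abs_def])
    have "(\<lambda>K. clip (real K) x ^ (2 * l)) \<longlonglongrightarrow> x ^ (2 * l)" for x
    proof (rule tendsto_eventually)
      show "\<forall>\<^sub>F K in sequentially. clip (real K) x ^ (2 * l) = x ^ (2 * l)"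
        using eventually_ge_at_top[of "nat \<lceil>\<bar>x\<bar>\<rceil>"]
        by eventually_elim (auto simp: clip_def abs_le_iff nat_le_iff ceiling_le_iff)
    qed
    then show "AE x in \<nu>. (\<lambda>K. clip (real K) x ^ (2 * l)) \<longlonglongrightarrow> x ^ (2 * l)" by simp
  qed (use mono_clip in \<open>auto intro!: \<nu>.integrable_clip_power simp: zero_le_even_power\<close>)
  then have "integrable \<nu> (\<lambda>x. 1 + x ^ (2 * l))" by simp
  then show ?thesis
  proof (rule Bochner_Integration.integrable_bound)
    have "\<bar>x ^ l\<bar> \<le> 1 + x ^ (2 * l)" for x :: real
      using sum_squares_bound[of 1 "\<bar>x ^ l\<bar>"] zero_le_even_power[of "2 * l" x]
      by (simp add: power_mult mult.commute[of 2] power2_eq_square power_mult_distrib)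
    then show "AE x in \<nu>. norm (x ^ l) \<le> norm (1 + x ^ (2 * l))"
      by (intro always_eventually allI) (metis abs_ge_self order_trans real_norm_def)
  qed auto
qed

text \<open>Truncation at level \<open>K\<close> costs at most a constant over \<open>K\<close>, uniformly along the sequence and for
  the limit, because all moments of order \<open>2 * l + 2\<close> are bounded. Hence the limits in the sequence
  index and in \<open>K\<close> can be interchanged.\<close>

lemma weak_limit_moment:
  fixes \<mu> :: "nat \<Rightarrow> real measure"
  assumes \<mu>: "\<And>n. real_distribution (\<mu> n)" and \<nu>: "real_distribution \<nu>"
    and int: "\<And>n l. integrable (\<mu> n) (\<lambda>x. x ^ l)"
    and lim: "\<And>l. (\<lambda>n. \<integral>x. x ^ l \<partial>\<mu> n) \<longlonglongrightarrow> m l"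
    and weak: "weak_conv_m \<mu> \<nu>"
  shows "(\<integral>x. x ^ l \<partial>\<nu>) = m l"
proof -
  interpret \<nu>: real_distribution \<nu> by fact
  note int' = weak_limit_integrable_power[OF assms]
  define B where "B = 2 * m (2 * l + 2) + 2 * (\<integral>x. x ^ (2 * l + 2) \<partial>\<nu>)"
  have bound: "\<bar>m l - (\<integral>x. x ^ l \<partial>\<nu>)\<bar> \<le> B / K" if "K \<ge> 1" for K
  proof -
    have "(\<lambda>n. \<integral>x. clip K x ^ l \<partial>\<mu> n) \<longlonglongrightarrow> (\<integral>x. clip K x ^ l \<partial>\<nu>)"
      by (rule weak_conv_imp_integral_bdd_continuous_conv[OF \<mu> \<nu> weak isCont_clip_power, of _ _ "K ^ l"])
         (use that in \<open>auto simp: power_abs intro!: power_mono abs_clip_le\<close>)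
    with lim[of l] have "(\<lambda>n. \<bar>(\<integral>x. x ^ l \<partial>\<mu> n) - (\<integral>x. clip K x ^ l \<partial>\<mu> n)\<bar>)
        \<longlonglongrightarrow> \<bar>m l - (\<integral>x. clip K x ^ l \<partial>\<nu>)\<bar>"
      by (intro tendsto_intros)
    moreover have "(\<lambda>n. 2 * (\<integral>x. x ^ (2 * l + 2) \<partial>\<mu> n) / K) \<longlonglongrightarrow> 2 * m (2 * l + 2) / K"
      using that by (intro tendsto_intros lim) auto
    ultimately have "\<bar>m l - (\<integral>x. clip K x ^ l \<partial>\<nu>)\<bar> \<le> 2 * m (2 * l + 2) / K"
      by (rule LIMSEQ_le)
         (use real_distribution.integral_clip_power_error[OF \<mu> that int] in auto)
    moreover have "\<bar>(\<integral>x. x ^ l \<partial>\<nu>) - (\<integral>x. clip K x ^ l \<partial>\<nu>)\<bar> \<le> 2 * (\<integral>x. x ^ (2 * l + 2) \<partial>\<nu>) / K"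
      by (rule \<nu>.integral_clip_power_error[OF that int'])
    ultimately show ?thesis by (simp add: B_def add_divide_distrib)
  qed
  have "(\<lambda>k. B / real (Suc k)) \<longlonglongrightarrow> 0"
    by (rule LIMSEQ_Suc) (rule lim_const_over_n)
  then have "\<bar>m l - (\<integral>x. x ^ l \<partial>\<nu>)\<bar> \<le> 0"
    by (rule LIMSEQ_le_const) (use bound in auto)
  then show ?thesis by simp
qed

lemma tight_if_second_moments_bounded:
  assumes \<mu>: "\<And>n. real_distribution (\<mu> n)"
    and int: "\<And>n. integrable (\<mu> n) (\<lambda>x. x\<^sup>2)"
    and C: "\<And>n. (\<integral>x. x\<^sup>2 \<partial>\<mu> n) \<le> C"
  shows "tight \<mu>"
  unfolding tight_def
proof (intro conjI allI impI \<mu>)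
  fix \<delta> :: real assume "\<delta> > 0"
  define K where "K = sqrt (\<bar>C\<bar> / \<delta>) + 1"
  have "K > 0" "K\<^sup>2 > \<bar>C\<bar> / \<delta>"
  proof -
    have s: "sqrt (\<bar>C\<bar> / \<delta>) \<ge> 0" using \<open>\<delta> > 0\<close> by simp
    then show "K > 0" unfolding K_def by linarith
    have "(sqrt (\<bar>C\<bar> / \<delta>))\<^sup>2 < K\<^sup>2" using s by (intro power_strict_mono) (auto simp: K_def)
    then show "K\<^sup>2 > \<bar>C\<bar> / \<delta>" using \<open>\<delta> > 0\<close> by simp
  qed
  have "measure (\<mu> n) {-K<..K} > 1 - \<delta>" for n
  proof -
    interpret real_distribution "\<mu> n" by (rule \<mu>)
    have "measure (\<mu> n) {x \<in> space (\<mu> n). x\<^sup>2 \<ge> K\<^sup>2} \<le> (\<integral>x. x\<^sup>2 \<partial>\<mu> n) / K\<^sup>2"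
      by (rule integral_Markov_inequality_measure[where A="{}"]) (use int \<open>K > 0\<close> in auto)
    also have "\<dots> \<le> \<bar>C\<bar> / K\<^sup>2" using C[of n] by (intro divide_right_mono) auto
    also have "\<dots> < \<delta>" using \<open>K\<^sup>2 > \<bar>C\<bar> / \<delta>\<close> \<open>\<delta> > 0\<close> \<open>K > 0\<close> by (simp add: field_simps)
    finally have "measure (\<mu> n) {x \<in> space (\<mu> n). x\<^sup>2 \<ge> K\<^sup>2} < \<delta>" .
    moreover have "1 = measure (\<mu> n) (space (\<mu> n))" by (rule prob_space[symmetric])
    moreover have "measure (\<mu> n) (space (\<mu> n)) \<le> measure (\<mu> n) ({-K<..K} \<union> {x \<in> space (\<mu> n). x\<^sup>2 \<ge> K\<^sup>2})"
    proof (rule finite_measure_mono)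
      show "space (\<mu> n) \<subseteq> {-K<..K} \<union> {x \<in> space (\<mu> n). x\<^sup>2 \<ge> K\<^sup>2}"
      proof
        fix x :: real
        show "x \<in> {-K<..K} \<union> {x \<in> space (\<mu> n). x\<^sup>2 \<ge> K\<^sup>2}"
          using \<open>K > 0\<close> abs_le_square_iff[of K x] by (cases "x \<in> {-K<..K}") auto
      qed
    qed auto
    moreover have "\<dots> \<le> measure (\<mu> n) {-K<..K} + measure (\<mu> n) {x \<in> space (\<mu> n). x\<^sup>2 \<ge> K\<^sup>2}"
      by (rule measure_Un_le) auto
    ultimately show ?thesis by linarith
  qed
  then show "\<exists>a b. a < b \<and> (\<forall>n. measure (\<mu> n) {a<..b} > 1 - \<delta>)"
    using \<open>K > 0\<close> by (intro exI[of _ "-K"] exI[of _ K]) auto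
qed

text \<open>Bounded second moments give tightness, so it suffices to identify the limit of any weakly
  convergent subsequence. Such a limit has the moments of \<open>\<nu>\<close>, and \<open>\<nu>\<close> is the only
  distribution with these moments.\<close>

theorem method_of_moments:
  fixes \<mu> :: "nat \<Rightarrow> real measure"
  assumes \<mu>: "\<And>n. real_distribution (\<mu> n)"
    and int: "\<And>n l. integrable (\<mu> n) (\<lambda>x. x ^ l)"
    and lim: "\<And>l. (\<lambda>n. \<integral>x. x ^ l \<partial>\<mu> n) \<longlonglongrightarrow> (\<integral>x. x ^ l \<partial>\<nu>)"
    and det: "characterized_by_moments \<nu>"
  shows "weak_conv_m \<mu> \<nu>"
proof (rule tight_subseq_weak_converge[OF \<mu>])
  show "real_distribution \<nu>" using det by (simp add: characterized_by_moments_def)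
  obtain C where "\<And>n. norm (\<integral>x. x\<^sup>2 \<partial>\<mu> n) \<le> C"
    using convergent_imp_Bseq[OF convergentI[OF lim[of 2]]] BseqE by blast
  then show "tight \<mu>"
    by (intro tight_if_second_moments_bounded[where C=C] \<mu> int) (simp add: abs_le_iff)
next
  fix s \<rho> assume s: "strict_mono (s :: nat \<Rightarrow> nat)" and \<rho>: "real_distribution \<rho>"
    and weak: "weak_conv_m (\<mu> \<circ> s) \<rho>"
  have lim': "(\<lambda>n. \<integral>x. x ^ l \<partial>(\<mu> \<circ> s) n) \<longlonglongrightarrow> (\<integral>x. x ^ l \<partial>\<nu>)" for l
    using LIMSEQ_subseq_LIMSEQ[OF lim s, of l] by (simp add: o_def)
  have "integrable \<rho> (\<lambda>x. x ^ l)" "(\<integral>x. x ^ l \<partial>\<rho>) = (\<integral>x. x ^ l \<partial>\<nu>)" for l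
    using weak_limit_integrable_power[OF _ \<rho> _ lim' weak, of l]
      weak_limit_moment[OF _ \<rho> _ lim' weak, of l] \<mu> int by auto
  then have "\<rho> = \<nu>" using det \<rho> unfolding characterized_by_moments_def by blast
  then show "weak_conv_m (\<mu> \<circ> s) \<nu>" using weak by simp
qed

section \<open>Empirical measures\<close>

lemma sum_mset_eq_sum_count:
  fixes f :: "'a \<Rightarrow> 'b::real_vector"
  assumes "finite A" "set_mset X \<subseteq> A"
  shows "(\<Sum>x\<in>#X. f x) = (\<Sum>x\<in>A. real (count X x) *\<^sub>R f x)"
  using assms(2)
proof (induction X)
  case (add a X)
  have "(\<Sum>x\<in>A. real (count (add_mset a X) x) *\<^sub>R f x)
      = (\<Sum>x\<in>A. real (count X x) *\<^sub>R f x) + (\<Sum>x\<in>A. if x = a then f x else 0)"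
    by (subst sum.distrib[symmetric], rule sum.cong) (auto simp: scaleR_left_distrib)
  then show ?case using add assms(1) by (simp add: sum.delta)
qed simp

lemma integral_empirical_measure:
  fixes f :: "'a::topological_space \<Rightarrow> 'b::{banach, second_countable_topology}"
  assumes "X \<noteq> {#}" and [measurable]: "f \<in> borel_measurable borel"
  shows "(\<integral>x. f x \<partial>empirical_measure X) = (\<Sum>x\<in>#X. f x) /\<^sub>R real (size X)"
proof -
  have "(\<integral>x. f x \<partial>empirical_measure X) = measure_pmf.expectation (pmf_of_multiset X) f"
    unfolding empirical_measure_def by (subst integral_distr) auto
  also have "\<dots> = (\<Sum>x\<in>set_mset X. (real (count X x) / real (size X)) *\<^sub>R f x)"
    using assms(1) by (subst integral_measure_pmf[of "set_mset X"]) auto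
  also have "\<dots> = (\<Sum>x\<in>set_mset X. real (count X x) *\<^sub>R f x) /\<^sub>R real (size X)"
    by (simp add: scaleR_sum_right divide_inverse mult.commute)
  also have "(\<Sum>x\<in>set_mset X. real (count X x) *\<^sub>R f x) = (\<Sum>x\<in>#X. f x)"
    by (rule sum_mset_eq_sum_count[symmetric]) auto
  finally show ?thesis .
qed

lemma integral_empirical_measure_list:
  fixes f :: "'a::topological_space \<Rightarrow> real"
  assumes "xs \<noteq> []" and "f \<in> borel_measurable borel"
  shows "(\<integral>x. f x \<partial>empirical_measure (mset xs)) = (\<Sum>x\<leftarrow>xs. f x) / real (length xs)"
proof -
  have "(\<Sum>x\<in>#mset xs. f x) = (\<Sum>x\<leftarrow>xs. f x)" by (metis mset_map sum_mset_sum_list)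
  then show ?thesis using integral_empirical_measure[of "mset xs" f] assms
    by (simp add: divide_inverse mult.commute)
qed

lemma integrable_empirical_measure:
  fixes f :: "'a::topological_space \<Rightarrow> 'b::{banach, second_countable_topology}"
  assumes "X \<noteq> {#}" and [measurable]: "f \<in> borel_measurable borel"
  shows "integrable (empirical_measure X) f"
  unfolding empirical_measure_def
  by (subst integrable_distr_eq) (use assms in \<open>auto intro!: integrable_measure_pmf_finite\<close>)

lemma real_distribution_empirical_measure:
  "real_distribution (empirical_measure (X :: real multiset))"
  unfolding empirical_measure_def
  by (simp add: real_distribution_def real_distribution_axioms_def measure_pmf.prob_space_distr)

lemma integral_empirical_points:
  assumes "N \<ge> 1"
  shows "(\<integral>t. t ^ l \<partial>empirical_points N x) = (\<Sum>i<N. x i ^ l) / real N"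
proof -
  have "image_mset x (mset_set {..<N}) \<noteq> {#}" using assms by (auto simp: mset_set_empty_iff lessThan_empty_iff)
  from integral_empirical_measure[OF this, of "\<lambda>t. t ^ l"] show ?thesis
    unfolding empirical_points_def
    by (simp add: image_mset.compositionality o_def sum_unfold_sum_mset divide_inverse mult.commute)
qed

section \<open>Determinants and the Andreief identity\<close>

lemma det_mat_Leibniz:
  fixes a :: "nat \<Rightarrow> nat \<Rightarrow> 'a::comm_ring_1"
  shows "Determinant.det (Matrix.mat N N (\<lambda>(i, j). a i j))
    = (\<Sum>p | p permutes {..<N}. of_int (sign p) * (\<Prod>i<N. a i (p i)))"
  by (subst det_def'[of _ N])
     (auto simp: atLeast0LessThan dest: permutes_in_image intro!: sum.cong prod.cong)

lemma det_scale_rows: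
  fixes a :: "nat \<Rightarrow> nat \<Rightarrow> 'a::comm_ring_1"
  shows "Determinant.det (Matrix.mat N N (\<lambda>(i, j). c i * a i j))
    = (\<Prod>i<N. c i) * Determinant.det (Matrix.mat N N (\<lambda>(i, j). a i j))"
  unfolding det_mat_Leibniz by (simp add: prod.distrib sum_distrib_left mult_ac)

lemma det_of_real:
  "Determinant.det (Matrix.mat N N (\<lambda>(i, j). of_real (a i j)))
    = (of_real (Determinant.det (Matrix.mat N N (\<lambda>(i, j). a i j))) :: 'a::{real_algebra_1,comm_ring_1})"
  unfolding det_mat_Leibniz by simp

text \<open>In each Leibniz term with permutation \<open>p\<close>, replacing column \<open>k\<close> brings in the factor \<open>h i\<close> for
  the single row \<open>i\<close> with \<open>p i = k\<close>. Summing over \<open>k\<close> therefore collects every \<open>h i\<close> exactly once.\<close>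

lemma sum_det_replace_column:
  fixes a :: "nat \<Rightarrow> nat \<Rightarrow> 'a::comm_ring_1"
  shows "(\<Sum>k<N. Determinant.det (Matrix.mat N N (\<lambda>(i, j). (if j = k then h i else 1) * a i j)))
    = (\<Sum>i<N. h i) * Determinant.det (Matrix.mat N N (\<lambda>(i, j). a i j))"
proof -
  have "(\<Sum>k<N. \<Prod>i<N. (if p i = k then h i else 1) * a i (p i)) = (\<Sum>i<N. h i) * (\<Prod>i<N. a i (p i))"
    if p: "p permutes {..<N}" for p
  proof -
    have "(\<Sum>k<N. \<Prod>i<N. (if p i = k then h i else 1) * a i (p i))
        = (\<Sum>k<N. \<Prod>i<N. if p i = k then h i else 1) * (\<Prod>i<N. a i (p i))"
      by (simp add: prod.distrib sum_distrib_right)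
    also have "(\<Sum>k<N. \<Prod>i<N. if p i = k then h i else 1)
        = (\<Sum>l<N. \<Prod>i<N. if p i = p l then h i else 1)"
      using sum.permute[OF p, of "\<lambda>k. \<Prod>i<N. if p i = k then h i else 1"] by (simp add: o_def)
    also have "\<dots> = (\<Sum>l<N. h l)"
      using permutes_inj[OF p] by (intro sum.cong refl) (simp add: inj_eq prod.delta)
    finally show ?thesis .
  qed
  then have "(\<Sum>p | p permutes {..<N}. of_int (sign p) * (\<Sum>k<N. \<Prod>i<N. (if p i = k then h i else 1) * a i (p i)))
      = (\<Sum>i<N. h i) * (\<Sum>p | p permutes {..<N}. of_int (sign p) * (\<Prod>i<N. a i (p i)))"
    by (simp add: sum_distrib_left mult_ac)
  then show ?thesis
    unfolding det_mat_Leibniz by (subst sum.swap) (simp add: sum_distrib_left)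
qed

lemma det_identity_replace_row:
  fixes b :: "nat \<Rightarrow> 'a::comm_ring_1"
  assumes "k < N"
  shows "Determinant.det (Matrix.mat N N (\<lambda>(i, j). if i = k then b j else if i = j then 1 else 0)) = b k"
proof -
  have "(\<Prod>i<N. if i = k then b (p i) else if i = p i then 1 else 0) = (if p = id then b k else 0)"
    if p: "p permutes {..<N}" for p
  proof (cases "\<forall>i<N. i \<noteq> k \<longrightarrow> p i = i")
    case True
    have fix_off: "p i = i" if "i \<noteq> k" for i
      using True that permutes_not_in[OF p, of i] by (cases "i < N") auto
    have "p k = k"
    proof (rule ccontr)
      assume "p k \<noteq> k"
      then have "p (p k) = p k" by (rule fix_off)
      then show False using \<open>p k \<noteq> k\<close> permutes_inj[OF p] by (simp add: inj_eq)
    qed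
    then have "p = id" using fix_off by (metis eq_id_iff)
    moreover from this have "(\<Prod>i<N. if i = k then b (p i) else if i = p i then 1 else 0)
        = (\<Prod>i<N. if i = k then b i else 1)"
      by (intro prod.cong) auto
    moreover have "\<dots> = b k" using assms by (simp add: prod.delta)
    ultimately show ?thesis by simp
  next
    case False
    then obtain i where i: "i < N" "i \<noteq> k" "i \<noteq> p i" by metis
    have "(\<Prod>i<N. if i = k then b (p i) else if i = p i then 1 else 0) = 0"
      by (intro prod_zero bexI[of _ i]) (use i in simp_all)
    then show ?thesis using False by auto
  qed
  then have "(\<Sum>p | p permutes {..<N}. of_int (sign p) *
        (\<Prod>i<N. if i = k then b (p i) else if i = p i then 1 else 0))
      = (\<Sum>p | p permutes {..<N}. if p = id then b k else 0)"
    by (intro sum.cong) auto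
  then show ?thesis
    unfolding det_mat_Leibniz by (simp add: sum.delta finite_permutations permutes_id)
qed

context sigma_finite_measure
begin

text \<open>The Andreief (Cauchy--Binet) identity: expanding both determinants, Fubini turns each pair of
  permutations \<open>p\<close>, \<open>q\<close> into a product of scalar products. For fixed \<open>p\<close>, the sum over \<open>q\<close> is the
  determinant of the Gram matrix with its rows permuted by \<open>p\<close>, and the two signs of \<open>p\<close> cancel; so
  each of the \<open>N!\<close> permutations \<open>p\<close> contributes the same determinant.\<close>

lemma Andreief:
  fixes F G :: "nat \<Rightarrow> 'a \<Rightarrow> 'b::{real_normed_field,banach,second_countable_topology}"
  assumes int: "\<And>k m. k < N \<Longrightarrow> m < N \<Longrightarrow> integrable M (\<lambda>x. F k x * G m x)"
  defines "D \<equiv> \<lambda>x. Determinant.det (Matrix.mat N N (\<lambda>(i, k). F k (x i)))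
     * Determinant.det (Matrix.mat N N (\<lambda>(i, k). G k (x i)))"
  shows "integrable (PiM {..<N} (\<lambda>_. M)) D"
    and "(\<integral>x. D x \<partial>PiM {..<N} (\<lambda>_. M))
      = fact N * Determinant.det (Matrix.mat N N (\<lambda>(k, m). \<integral>x. F k x * G m x \<partial>M))"
proof -
  interpret product_sigma_finite "\<lambda>_::nat. M" by unfold_locales
  define S where "S = {p. p permutes {..<N}}"
  define A where "A k m = (\<integral>x. F k x * G m x \<partial>M)" for k m
  have D: "D = (\<lambda>x. \<Sum>p\<in>S. \<Sum>q\<in>S. of_int (sign p * sign q) * (\<Prod>i<N. F (p i) (x i) * G (q i) (x i)))"
    unfolding D_def det_mat_Leibniz S_def sum_product by (simp add: prod.distrib mult_ac)
  have p_less: "p i < N" if "p \<in> S" "i < N" for p i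
    using that permutes_in_image[of p "{..<N}" i] by (simp add: S_def)
  have int_prod: "integrable (PiM {..<N} (\<lambda>_. M)) (\<lambda>x. \<Prod>i<N. F (p i) (x i) * G (q i) (x i))"
    if "p \<in> S" "q \<in> S" for p q
    by (rule product_integrable_prod) (use that p_less int in auto)
  then show "integrable (PiM {..<N} (\<lambda>_. M)) D"
    unfolding D by (intro Bochner_Integration.integrable_sum integrable_mult_right)
  have "(\<integral>x. D x \<partial>PiM {..<N} (\<lambda>_. M))
      = (\<Sum>p\<in>S. \<Sum>q\<in>S. of_int (sign p * sign q) * (\<Prod>i<N. A (p i) (q i)))"
    unfolding D
  proof (subst Bochner_Integration.integral_sum, goal_cases)
    case 2
    show ?case
    proof (intro sum.cong refl, subst Bochner_Integration.integral_sum, goal_cases)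
      case (2 p)
      show ?case
      proof (intro sum.cong refl)
        fix q assume "q \<in> S"
        have "(\<integral>x. (\<Prod>i<N. F (p i) (x i) * G (q i) (x i)) \<partial>PiM {..<N} (\<lambda>_. M)) = (\<Prod>i<N. A (p i) (q i))"
          unfolding A_def by (rule product_integral_prod) (use 2 \<open>q \<in> S\<close> p_less int in auto)
        then show "(\<integral>x. of_int (sign p * sign q) * (\<Prod>i<N. F (p i) (x i) * G (q i) (x i)) \<partial>PiM {..<N} (\<lambda>_. M))
            = of_int (sign p * sign q) * (\<Prod>i<N. A (p i) (q i))"
          by (subst integral_mult_right_zero) simp
      qed
    qed (use int_prod in auto)
  qed (use int_prod in auto)
  also have "\<dots> = (\<Sum>p\<in>S. Determinant.det (Matrix.mat N N (\<lambda>(k, m). A k m)))"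
  proof (rule sum.cong[OF refl])
    fix p assume p: "p \<in> S"
    have "(\<Sum>q\<in>S. of_int (sign p * sign q) * (\<Prod>i<N. A (p i) (q i)))
        = of_int (sign p) * Determinant.det (Matrix.mat N N (\<lambda>(i, j). A (p i) j))"
      unfolding det_mat_Leibniz S_def by (simp add: sum_distrib_left mult.assoc)
    also have "Determinant.det (Matrix.mat N N (\<lambda>(i, j). A (p i) j))
        = Determinant.det (Matrix.mat N N (\<lambda>(i, j). Matrix.mat N N (\<lambda>(k, m). A k m) $$ (p i, j)))"
      using p_less[OF p] by (intro arg_cong[where f=Determinant.det] eq_matI) auto
    also have "\<dots> = of_int (sign p) * Determinant.det (Matrix.mat N N (\<lambda>(k, m). A k m))"
      by (rule det_permute_rows) (use p in \<open>auto simp: S_def atLeast0LessThan\<close>)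
    finally show "(\<Sum>q\<in>S. of_int (sign p * sign q) * (\<Prod>i<N. A (p i) (q i)))
        = Determinant.det (Matrix.mat N N (\<lambda>(k, m). A k m))"
      by (simp add: mult.assoc[symmetric] of_int_mult[symmetric] sign_idempotent del: of_int_mult)
  qed
  also have "\<dots> = fact N * Determinant.det (Matrix.mat N N (\<lambda>(k, m). A k m))"
    by (simp add: S_def card_permutations[of "{..<N}" N])
  finally show "(\<integral>x. D x \<partial>PiM {..<N} (\<lambda>_. M))
      = fact N * Determinant.det (Matrix.mat N N (\<lambda>(k, m). \<integral>x. F k x * G m x \<partial>M))"
    by (simp add: A_def)
qed

end

section \<open>Reduction to sigma-finite reference measures\<close>

lemma integrable_mult_in_L2:
  assumes "in_L2 M f" "in_L2 M g"
  shows "integrable M (\<lambda>x. f x * g x)"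
proof (rule Bochner_Integration.integrable_bound)
  show "integrable M (\<lambda>x. (f x)\<^sup>2 + (g x)\<^sup>2)" using assms by (auto simp: in_L2_def)
  have "\<bar>a * b\<bar> \<le> a\<^sup>2 + b\<^sup>2" for a b :: real
    using sum_squares_bound[of "\<bar>a\<bar>" "\<bar>b\<bar>"] mult_nonneg_nonneg[of "\<bar>a\<bar>" "\<bar>b\<bar>"]
    unfolding abs_mult power2_abs by linarith
  then show "AE x in M. norm (f x * g x) \<le> norm ((f x)\<^sup>2 + (g x)\<^sup>2)"
    by simp
qed (use assms in \<open>auto simp: in_L2_def\<close>)

text \<open>By Markov's inequality the sets \<open>{f k ^ 2 \<ge> 1 / (n + 1)}\<close> have finite measure, and they exhaust
  the set where some \<open>f k\<close> does not vanish.\<close>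

lemma sigma_finite_density_support:
  fixes f :: "'i::countable \<Rightarrow> 'a \<Rightarrow> real"
  assumes f: "\<And>k. k \<in> K \<Longrightarrow> integrable M (\<lambda>x. (f k x)\<^sup>2)"
    and meas [measurable]: "\<And>k. k \<in> K \<Longrightarrow> f k \<in> borel_measurable M"
  shows "sigma_finite_measure (density M (indicator {x \<in> space M. \<exists>k\<in>K. f k x \<noteq> 0}))"
proof
  define S where "S = {x \<in> space M. \<exists>k\<in>K. f k x \<noteq> 0}"
  define B where "B k n = {x \<in> space M. (f k x)\<^sup>2 \<ge> 1 / real (Suc n)}" for k n
  have S: "S = (\<Union>k\<in>K. {x \<in> space M. f k x \<noteq> 0})" by (auto simp: S_def)
  have S_meas [measurable]: "S \<in> sets M" unfolding S
    by (intro sets.countable_UN' countableI_type) (auto intro: measurable_sets)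
  have B_meas [measurable]: "B k n \<in> sets M" if "k \<in> K" for k n
    using meas[OF that] unfolding B_def by measurable
  have B_fin: "emeasure M (B k n) \<noteq> \<infinity>" if "k \<in> K" for k n
  proof -
    have "emeasure M (B k n) \<le> ennreal (1 / (1 / real (Suc n)) * (\<integral>x. (f k x)\<^sup>2 \<partial>M))"
      unfolding B_def by (rule integral_Markov_inequality) (use f that in auto)
    from neq_top_trans[OF ennreal_neq_top this] show ?thesis by simp
  qed
  define \<A> where "\<A> = insert (space M - S) ((\<lambda>(k, n). B k n) ` (K \<times> UNIV))"
  have "countable \<A>" unfolding \<A>_def by (intro countable_insert countable_image countableI_type)
  moreover have "\<A> \<subseteq> sets (density M (indicator S))" by (auto simp: \<A>_def)
  moreover have "\<Union>\<A> = space (density M (indicator S))"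
  proof -
    have "x \<in> \<Union>\<A>" if x: "x \<in> S" for x
    proof -
      obtain k where k: "k \<in> K" "f k x \<noteq> 0" "x \<in> space M" using x by (auto simp: S_def)
      then have "(f k x)\<^sup>2 > 0" by simp
      then obtain n where "1 / real (Suc n) < (f k x)\<^sup>2" using nat_approx_posE by blast
      then have "x \<in> B k n" using k by (simp add: B_def)
      then show ?thesis using k by (auto simp: \<A>_def)
    qed
    moreover have "\<Union>\<A> \<subseteq> space M" by (auto simp: \<A>_def B_def)
    ultimately show ?thesis by (auto simp: \<A>_def)
  qed
  moreover have "emeasure (density M (indicator S)) a \<noteq> \<infinity>" if "a \<in> \<A>" for a
    using that unfolding \<A>_def
  proof
    assume "a = space M - S"
    then show ?thesis by (simp add: emeasure_density indicator_inter_arith[symmetric] Diff_Int_distrib)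
  next
    assume "a \<in> (\<lambda>(k, n). B k n) ` (K \<times> UNIV)"
    then obtain k n where a: "k \<in> K" "a = B k n" by auto
    have "emeasure (density M (indicator S)) a = emeasure M (S \<inter> a)"
      using a by (simp add: emeasure_density indicator_inter_arith[symmetric] nn_integral_indicator)
    also have "\<dots> \<le> emeasure M a" using a by (intro emeasure_mono) auto
    finally show ?thesis using B_fin[OF a(1), of n] a(2) neq_top_trans by auto
  qed
  ultimately show "\<exists>A. countable A \<and> A \<subseteq> sets (density M (indicator {x \<in> space M. \<exists>k\<in>K. f k x \<noteq> 0})) \<and>
      \<Union>A = space (density M (indicator {x \<in> space M. \<exists>k\<in>K. f k x \<noteq> 0})) \<and>
      (\<forall>a\<in>A. emeasure (density M (indicator {x \<in> space M. \<exists>k\<in>K. f k x \<noteq> 0})) a \<noteq> \<infinity>)"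
    unfolding S_def[symmetric] by (intro exI[of _ \<A>] conjI ballI) simp_all
qed

text \<open>When no measure with the prescribed values exists, \<open>extend_measure\<close> is the zero measure. So a
  single set of nonzero measure certifies that the prescribed values are attained.\<close>

lemma emeasure_extend_measure_of_nonnull:
  assumes M: "M = extend_measure \<Omega> I G \<mu>" and G: "G ` I \<subseteq> Pow \<Omega>"
    and nonnull: "emeasure M X \<noteq> 0" and i: "i \<in> I"
  shows "emeasure M (G i) = \<mu> i"
proof -
  have "\<exists>\<mu>'. (\<forall>i\<in>I. \<mu>' (G i) = \<mu> i) \<and> measure_space \<Omega> (sigma_sets \<Omega> (G ` I)) \<mu>'"
  proof (rule ccontr)
    assume "\<not> ?thesis"
    then have "M = measure_of \<Omega> (G ` I) (\<lambda>_. 0)" unfolding M extend_measure_def by (simp only: simp_thms if_False)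
    then show False using nonnull by (simp add: emeasure_sigma)
  qed
  then obtain \<mu>' where \<mu>': "\<And>i. i \<in> I \<Longrightarrow> \<mu>' (G i) = \<mu> i"
    and "measure_space \<Omega> (sigma_sets \<Omega> (G ` I)) \<mu>'" by blast
  then have "positive (sets M) \<mu>'" "countably_additive (sets M) \<mu>'"
    by (simp_all add: M sets_extend_measure[OF G] measure_space_def)
  then show ?thesis using \<mu>' by (intro emeasure_extend_measure[OF M _ G _ _ i, where \<mu>'=\<mu>'])
qed

lemma emeasure_PiM_of_nonnull:
  assumes "finite I" and nonnull: "emeasure (PiM I M) X \<noteq> 0"
    and A: "\<And>i. i \<in> I \<Longrightarrow> A i \<in> sets (M i)"
  shows "emeasure (PiM I M) (PiE I A) = (\<Prod>i\<in>I. emeasure (M i) (A i))"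
proof -
  have "emeasure (PiM I M) (prod_emb I M I (PiE I A))
      = (\<Prod>i\<in>I \<union> {i \<in> I. emeasure (M i) (space (M i)) \<noteq> 1}.
          if i \<in> I then emeasure (M i) (A i) else emeasure (M i) (space (M i)))"
    using emeasure_extend_measure_of_nonnull[OF PiM_def _ nonnull, of "(I, A)"] assms
    by (auto simp: prod_emb_def)
  also have "\<dots> = (\<Prod>i\<in>I. emeasure (M i) (A i))" by (auto intro!: prod.cong)
  finally show ?thesis using A by (simp add: prod_emb_PiE_same_index sets.sets_into_space)
qed

text \<open>Without sigma-finiteness a product measure is not determined by its values on boxes. On the
  boxes inside \<open>S\<close>, however, it agrees with the product of the restrictions to \<open>S\<close>, and these are
  sigma-finite, so that uniqueness of product measures applies on that part.\<close>

lemma PiM_density_indicator: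
  assumes sf: "sigma_finite_measure (density M (indicator S))" and S [measurable]: "S \<in> sets M"
    and fin: "finite I"
    and nonnull: "emeasure (PiM I (\<lambda>_. M)) X \<noteq> 0"
  shows "PiM I (\<lambda>_. density M (indicator S)) = density (PiM I (\<lambda>_. M)) (indicator (PiE I (\<lambda>_. S)))"
proof -
  interpret sigma_finite_measure "density M (indicator S)" by (rule sf)
  interpret product_sigma_finite "\<lambda>_. density M (indicator S)" by unfold_locales
  have box [measurable]: "PiE I A \<in> sets (PiM I (\<lambda>_. M))" if "\<And>i. i \<in> I \<Longrightarrow> A i \<in> sets M" for A
    using that fin by (intro sets_PiM_I_finite) auto
  show ?thesis
  proof (rule PiM_eqI[OF fin, symmetric])
    show "sets (density (PiM I (\<lambda>_. M)) (indicator (PiE I (\<lambda>_. S)))) = sets (PiM I (\<lambda>_. density M (indicator S)))"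
      by (simp cong: sets_PiM_cong)
  next
    fix A assume "\<And>i. i \<in> I \<Longrightarrow> A i \<in> sets (density M (indicator S))"
    then have A: "A i \<in> sets M" if "i \<in> I" for i using that by simp
    have "emeasure (density (PiM I (\<lambda>_. M)) (indicator (PiE I (\<lambda>_. S)))) (PiE I A)
        = emeasure (PiM I (\<lambda>_. M)) (PiE I (\<lambda>_. S) \<inter> PiE I A)"
      using box[OF A] box[OF S]
      by (simp add: emeasure_density indicator_inter_arith[symmetric] nn_integral_indicator)
    also have "PiE I (\<lambda>_. S) \<inter> PiE I A = PiE I (\<lambda>i. S \<inter> A i)" by (rule PiE_Int)
    also have "emeasure (PiM I (\<lambda>_. M)) (PiE I (\<lambda>i. S \<inter> A i)) = (\<Prod>i\<in>I. emeasure M (S \<inter> A i))"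
      by (rule emeasure_PiM_of_nonnull[OF fin nonnull]) (use A in auto)
    also have "\<dots> = (\<Prod>i\<in>I. emeasure (density M (indicator S)) (A i))"
      using A by (intro prod.cong refl)
        (simp add: emeasure_density indicator_inter_arith[symmetric] nn_integral_indicator)
    finally show "emeasure (density (PiM I (\<lambda>_. M)) (indicator (PiE I (\<lambda>_. S)))) (PiE I A)
        = (\<Prod>i\<in>I. emeasure (density M (indicator S)) (A i))" .
  qed
qed

lemma be_weight_measurable:
  assumes [measurable]: "\<And>k. k < N \<Longrightarrow> P k \<in> borel_measurable M" "\<And>k. k < N \<Longrightarrow> Q k \<in> borel_measurable M"
  shows "be_weight N P Q \<in> borel_measurable (PiM {..<N} (\<lambda>_. M))"
proof -
  have *: "(\<lambda>x. R (p i) (x i)) \<in> borel_measurable (PiM {..<N} (\<lambda>_. M))"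
    if "p permutes {..<N}" "i < N" "\<And>k. k < N \<Longrightarrow> R k \<in> borel_measurable M" for R :: "nat \<Rightarrow> _ \<Rightarrow> real" and p i
    using that permutes_in_image[of p "{..<N}" i]
    by (intro measurable_compose[OF measurable_component_singleton]) auto
  show ?thesis
    unfolding be_weight_def[abs_def] det_mat_Leibniz
    by (intro borel_measurable_times borel_measurable_sum borel_measurable_prod borel_measurable_const *)
       (use assms in auto)
qed

lemma be_weight_eq_0:
  assumes "i < N" "\<And>k. k < N \<Longrightarrow> P k (x i) = 0"
  shows "be_weight N P Q x = 0"
proof -
  have "(\<Prod>j<N. P (p j) (x j)) = 0" if "p permutes {..<N}" for p
    using assms permutes_in_image[OF that, of i] by (intro prod_zero) auto
  then have "(\<Sum>p | p permutes {..<N}. of_int (sign p) * (\<Prod>j<N. P (p j) (x j))) = 0"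
    by (intro sum.neutral ballI) (simp only: mem_Collect_eq mult_zero_right)
  then show ?thesis unfolding be_weight_def det_mat_Leibniz by simp
qed

text \<open>A density of total mass 1 with respect to the product measure forces the latter to be
  nonzero.\<close>

lemma emeasure_PiM_ensemble_nonnull:
  assumes "biorthogonal_ensemble N M P Q"
  shows "emeasure (PiM {..<N} (\<lambda>_. M)) (space (PiM {..<N} (\<lambda>_. M))) \<noteq> 0"
proof
  let ?P = "PiM {..<N} (\<lambda>_. M)"
  interpret prob_space "be_law N M P Q" using assms by (simp add: biorthogonal_ensemble_def)
  have [measurable]: "be_weight N P Q \<in> borel_measurable ?P"
    using assms by (intro be_weight_measurable) (auto simp: biorthogonal_ensemble_def in_L2_def)
  assume "emeasure ?P (space ?P) = 0"
  then have "AE x in ?P. False" by (subst AE_iff_measurable[OF _ refl]) auto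
  then have "(\<integral>\<^sup>+x. ennreal (be_weight N P Q x) * indicator (space ?P) x \<partial>?P) = 0"
    by (subst nn_integral_0_iff_AE) auto
  then have "emeasure (be_law N M P Q) (space ?P) = 0"
    unfolding be_law_def by (subst emeasure_density) auto
  then show False using emeasure_space_1 by (simp add: be_law_def)
qed

text \<open>The reference measure of an ensemble may be replaced by a sigma-finite one, which makes Fubini's
  theorem available. The first determinant in the weight has a zero row as soon as one point lies
  outside \<open>S = {x. \<exists>k<N. P k x \<noteq> 0}\<close>, so restricting the measure to \<open>S\<close> changes neither the
  law nor the integrals of functions with a factor \<open>P k\<close>; and \<open>S\<close> is sigma-finite since the
  \<open>P k\<close> are square integrable.\<close>

lemma sigma_finite_representative:
  assumes be: "biorthogonal_ensemble N M P Q"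
  obtains M' where "sigma_finite_measure M'" "biorthogonal_ensemble N M' P Q"
    "be_law N M' P Q = be_law N M P Q"
    "\<And>k f. k < N \<Longrightarrow> integrable M (\<lambda>x. f x * P k x) \<Longrightarrow> integrable M' (\<lambda>x. f x * P k x)"
    "\<And>k f. k < N \<Longrightarrow> (\<lambda>x. f x * P k x) \<in> borel_measurable M
      \<Longrightarrow> (\<integral>x. f x * P k x \<partial>M') = (\<integral>x. f x * P k x \<partial>M)"
proof
  define S where "S = {x \<in> space M. \<exists>k\<in>{..<N}. P k x \<noteq> 0}"
  define M' where "M' = density M (indicator S)"
  have P_meas [measurable]: "P k \<in> borel_measurable M" if "k < N" for k
    using be that by (auto simp: biorthogonal_ensemble_def in_L2_def)
  have Q_meas [measurable]: "Q k \<in> borel_measurable M" if "k < N" for k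
    using be that by (auto simp: biorthogonal_ensemble_def in_L2_def)
  have "S = (\<Union>k\<in>{..<N}. {x \<in> space M. P k x \<noteq> 0})" by (auto simp: S_def)
  also have "\<dots> \<in> sets M" by (intro sets.finite_UN) auto
  finally have S [measurable]: "S \<in> sets M" .
  show sf: "sigma_finite_measure M'" unfolding M'_def S_def
    by (rule sigma_finite_density_support) (use be in \<open>auto simp: biorthogonal_ensemble_def in_L2_def\<close>)
  have sets: "sets M' = sets M" by (simp add: M'_def)
  have meas_iff: "borel_measurable M' = borel_measurable M" by (rule measurable_cong_sets) (auto simp: sets)
  have int_iff: "integrable M' (\<lambda>x. f x * P k x) \<longleftrightarrow> integrable M (\<lambda>x. f x * P k x)"
    if "k < N" "(\<lambda>x. f x * P k x) \<in> borel_measurable M" for f k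
    unfolding M'_def using that
    by (subst ennreal_indicator[symmetric, abs_def], subst integrable_density)
       (auto intro!: Bochner_Integration.integrable_cong simp: S_def indicator_def)
  have int_eq: "(\<integral>x. f x * P k x \<partial>M') = (\<integral>x. f x * P k x \<partial>M)"
    if "k < N" "(\<lambda>x. f x * P k x) \<in> borel_measurable M" for f k
    unfolding M'_def using that
    by (subst ennreal_indicator[symmetric, abs_def], subst integral_density)
       (auto intro!: Bochner_Integration.integral_cong simp: S_def indicator_def)
  show "integrable M' (\<lambda>x. f x * P k x)" if "k < N" "integrable M (\<lambda>x. f x * P k x)" for k f
    using int_iff that by blast
  show "(\<integral>x. f x * P k x \<partial>M') = (\<integral>x. f x * P k x \<partial>M)"
    if "k < N" "(\<lambda>x. f x * P k x) \<in> borel_measurable M" for k f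
    using int_eq that by blast
  have PiM': "PiM {..<N} (\<lambda>_. M') = density (PiM {..<N} (\<lambda>_. M)) (indicator (PiE {..<N} (\<lambda>_. S)))"
    unfolding M'_def
    by (rule PiM_density_indicator) (use sf emeasure_PiM_ensemble_nonnull[OF be] in \<open>auto simp: M'_def\<close>)
  have [measurable]: "be_weight N P Q \<in> borel_measurable (PiM {..<N} (\<lambda>_. M))"
    by (rule be_weight_measurable) auto
  have [measurable]: "PiE {..<N} (\<lambda>_. S) \<in> sets (PiM {..<N} (\<lambda>_. M))"
    by (intro sets_PiM_I_finite) auto
  have "indicator (PiE {..<N} (\<lambda>_. S)) x * ennreal (be_weight N P Q x) = ennreal (be_weight N P Q x)"
    if "x \<in> space (PiM {..<N} (\<lambda>_. M))" for x
  proof (cases "x \<in> PiE {..<N} (\<lambda>_. S)")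
    case False
    have x: "x \<in> PiE {..<N} (\<lambda>_. space M)" using that by (simp add: space_PiM)
    with False obtain i where "i < N" "x i \<notin> S" by (auto simp: PiE_iff)
    moreover from this x have "x i \<in> space M" by auto
    ultimately have "be_weight N P Q x = 0" by (intro be_weight_eq_0[of i]) (auto simp: S_def)
    then show ?thesis by simp
  qed simp
  then show law: "be_law N M' P Q = be_law N M P Q"
    unfolding be_law_def PiM' by (subst density_density_eq) (auto intro!: density_cong)
  show "biorthogonal_ensemble N M' P Q"
    unfolding biorthogonal_ensemble_def
  proof (intro conjI allI impI)
    show "sets M' = sets borel" using be by (simp add: sets biorthogonal_ensemble_def)
    show "prob_space (be_law N M' P Q)" using be law by (simp add: biorthogonal_ensemble_def)
    show "AE x in PiM {..<N} (\<lambda>_. M'). be_weight N P Q x \<ge> 0"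
      unfolding PiM' using be by (subst AE_density) (auto simp: biorthogonal_ensemble_def)
  next
    fix k assume k: "k < N"
    show "in_L2 M' (P k)"
      using be k int_iff[OF k, of "P k"] by (auto simp: biorthogonal_ensemble_def in_L2_def meas_iff power2_eq_square)
    have "integrable M (\<lambda>x. indicator S x *\<^sub>R (Q k x)\<^sup>2)"
      using be k by (intro integrable_mult_indicator) (auto simp: biorthogonal_ensemble_def in_L2_def)
    then have "integrable M' (\<lambda>x. (Q k x)\<^sup>2)"
      unfolding M'_def using k
      by (subst ennreal_indicator[symmetric, abs_def], subst integrable_density) auto
    then show "in_L2 M' (Q k)"
      using be k by (auto simp: biorthogonal_ensemble_def in_L2_def meas_iff)
  next
    fix k m assume "k < N" "m < N"
    then show "L2_inner M' (P k) (Q m) = (if k = m then 1 else 0)"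
      using int_eq[of k "Q m"] be by (auto simp: L2_inner_def biorthogonal_ensemble_def mult.commute)
  qed
qed

section \<open>Expectations in a biorthogonal ensemble\<close>

lemma integral_be_law:
  fixes f :: "(nat \<Rightarrow> real) \<Rightarrow> 'b::{banach, second_countable_topology}"
  assumes "biorthogonal_ensemble N M P Q" and f: "f \<in> borel_measurable (PiM {..<N} (\<lambda>_. M))"
  shows "(\<integral>x. f x \<partial>be_law N M P Q) = (\<integral>x. be_weight N P Q x *\<^sub>R f x \<partial>PiM {..<N} (\<lambda>_. M))"
  unfolding be_law_def
  by (rule integral_density[OF f])
     (use assms in \<open>auto intro!: be_weight_measurable simp: biorthogonal_ensemble_def in_L2_def\<close>)

lemma measurable_component_real:
  assumes "sets M = sets borel" "i < N"
  shows "(\<lambda>x. x i :: real) \<in> borel_measurable (PiM {..<N} (\<lambda>_. M))"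
  using measurable_component_singleton[of i "{..<N}" "\<lambda>_. M"] assms
  by (simp add: measurable_cong_sets[OF refl assms(1)])

text \<open>The product of the \<open>z - x i\<close> is absorbed into the rows of the first determinant, so the average
  characteristic polynomial is the determinant of the Gram matrix of \<open>(z - x) P k\<close> and \<open>Q m\<close>.\<close>

lemma avg_char_be_law:
  assumes be: "biorthogonal_ensemble N M P Q"
    and int: "\<And>k m. k < N \<Longrightarrow> m < N \<Longrightarrow> integrable M (\<lambda>x. x * P k x * Q m x)"
  shows "avg_char N (be_law N M P Q) z = Determinant.det (Matrix.mat N N
    (\<lambda>(k, m). (if k = m then z else 0) - complex_of_real (L2_inner M (\<lambda>x. x * P k x) (Q m))))"
proof -
  obtain M' where "sigma_finite_measure M'" and be': "biorthogonal_ensemble N M' P Q"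
    and law: "be_law N M' P Q = be_law N M P Q"
    and int': "\<And>k f. k < N \<Longrightarrow> integrable M (\<lambda>x. f x * P k x) \<Longrightarrow> integrable M' (\<lambda>x. f x * P k x)"
    and eq': "\<And>k f. k < N \<Longrightarrow> (\<lambda>x. f x * P k x) \<in> borel_measurable M
      \<Longrightarrow> (\<integral>x. f x * P k x \<partial>M') = (\<integral>x. f x * P k x \<partial>M)"
    using sigma_finite_representative[OF be] by blast
  interpret sigma_finite_measure M' by fact
  define F where "F k t = (z - complex_of_real t) * complex_of_real (P k t)" for k t
  define G where "G k t = complex_of_real (Q k t)" for k t
  have PQ: "integrable M' (\<lambda>x. P k x * Q m x)"
    "(\<integral>x. P k x * Q m x \<partial>M') = (if k = m then 1 else 0)" if "k < N" "m < N" for k m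
    using be' that by (auto simp: biorthogonal_ensemble_def L2_inner_def intro!: integrable_mult_in_L2)
  have xPQ: "integrable M' (\<lambda>x. x * P k x * Q m x)"
    "(\<integral>x. x * P k x * Q m x \<partial>M') = (\<integral>x. x * P k x * Q m x \<partial>M)" if "k < N" "m < N" for k m
    using int'[of k "\<lambda>x. x * Q m x"] eq'[of k "\<lambda>x. x * Q m x"] int[OF that] that
    by (simp_all add: mult_ac)
  have FG: "F k t * G m t = z * complex_of_real (P k t * Q m t) - complex_of_real (t * P k t * Q m t)" for k m t
    by (simp add: F_def G_def algebra_simps)
  have FG_int: "integrable M' (\<lambda>t. F k t * G m t)"
    "(\<integral>t. F k t * G m t \<partial>M') = (if k = m then z else 0) - complex_of_real (L2_inner M (\<lambda>x. x * P k x) (Q m))"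
    if "k < N" "m < N" for k m
  proof -
    have i: "integrable M' (\<lambda>t. z * complex_of_real (P k t * Q m t))"
      "integrable M' (\<lambda>t. complex_of_real (t * P k t * Q m t))"
      using PQ(1)[OF that] xPQ(1)[OF that]
      by (auto intro!: integrable_mult_right integrable_of_real simp del: of_real_mult)
    show "integrable M' (\<lambda>t. F k t * G m t)" unfolding FG by (intro Bochner_Integration.integrable_diff i)
    have "(\<integral>t. F k t * G m t \<partial>M')
        = z * (\<integral>t. complex_of_real (P k t * Q m t) \<partial>M') - (\<integral>t. complex_of_real (t * P k t * Q m t) \<partial>M')"
      unfolding FG Bochner_Integration.integral_diff[OF i] integral_mult_right_zero ..
    then show "(\<integral>t. F k t * G m t \<partial>M') = (if k = m then z else 0) - complex_of_real (L2_inner M (\<lambda>x. x * P k x) (Q m))"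
      unfolding integral_complex_of_real using PQ(2)[OF that] xPQ(2)[OF that] by (simp add: L2_inner_def)
  qed
  have sets: "sets M' = sets borel" using be' by (simp add: biorthogonal_ensemble_def)
  have of_real_meas: "complex_of_real \<in> borel_measurable borel"
    by (intro borel_measurable_continuous_onI continuous_intros)
  have "avg_char N (be_law N M P Q) z
      = (\<integral>x. be_weight N P Q x *\<^sub>R (\<Prod>i<N. z - complex_of_real (x i)) \<partial>PiM {..<N} (\<lambda>_. M'))"
    unfolding avg_char_def law[symmetric]
    by (intro integral_be_law be' borel_measurable_prod borel_measurable_diff borel_measurable_const
        measurable_compose[OF measurable_component_real[OF sets] of_real_meas]) auto
  also have "\<dots> = (\<integral>x. 1 / fact N * (Determinant.det (Matrix.mat N N (\<lambda>(i, k). F k (x i)))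
     * Determinant.det (Matrix.mat N N (\<lambda>(i, k). G k (x i)))) \<partial>PiM {..<N} (\<lambda>_. M'))"
    unfolding F_def G_def det_scale_rows det_of_real be_weight_def
    by (simp add: scaleR_conv_of_real mult_ac)
  also have "\<dots> = Determinant.det (Matrix.mat N N (\<lambda>(k, m). \<integral>t. F k t * G m t \<partial>M'))"
    using Andreief(2)[of N F G] FG_int(1) by simp
  also have "Matrix.mat N N (\<lambda>(k, m). \<integral>t. F k t * G m t \<partial>M') = Matrix.mat N N
    (\<lambda>(k, m). (if k = m then z else 0) - complex_of_real (L2_inner M (\<lambda>x. x * P k x) (Q m)))"
    by (intro eq_matI) (simp_all add: FG_int(2))
  finally show ?thesis .
qed

text \<open>The sum of the \<open>h (x i)\<close> times the first determinant is the sum over \<open>k\<close> of that determinant with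
  \<open>P k\<close> replaced by \<open>h P k\<close>. By biorthogonality, the resulting Gram matrix is the identity except for
  row \<open>k\<close>, so its determinant is the diagonal entry of that row.\<close>

lemma expectation_linear_statistic:
  assumes be: "biorthogonal_ensemble N M P Q" and h [measurable]: "h \<in> borel_measurable borel"
    and int: "\<And>k m. k < N \<Longrightarrow> m < N \<Longrightarrow> integrable M (\<lambda>x. h x * P k x * Q m x)"
  shows "(\<integral>x. (\<Sum>i<N. h (x i)) \<partial>be_law N M P Q) = (\<Sum>k<N. L2_inner M (\<lambda>x. h x * P k x) (Q k))"
proof -
  obtain M' where "sigma_finite_measure M'" and be': "biorthogonal_ensemble N M' P Q"
    and law: "be_law N M' P Q = be_law N M P Q"
    and int': "\<And>k f. k < N \<Longrightarrow> integrable M (\<lambda>x. f x * P k x) \<Longrightarrow> integrable M' (\<lambda>x. f x * P k x)"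
    and eq': "\<And>k f. k < N \<Longrightarrow> (\<lambda>x. f x * P k x) \<in> borel_measurable M
      \<Longrightarrow> (\<integral>x. f x * P k x \<partial>M') = (\<integral>x. f x * P k x \<partial>M)"
    using sigma_finite_representative[OF be] by blast
  interpret sigma_finite_measure M' by fact
  define F where "F k j t = (if j = k then h t else 1) * P j t" for k j :: nat and t
  have PQ: "integrable M' (\<lambda>x. P k x * Q m x)"
    "(\<integral>x. P k x * Q m x \<partial>M') = (if k = m then 1 else 0)" if "k < N" "m < N" for k m
    using be' that by (auto simp: biorthogonal_ensemble_def L2_inner_def intro!: integrable_mult_in_L2)
  have hPQ: "integrable M' (\<lambda>x. h x * P k x * Q m x)"
    "(\<integral>x. h x * P k x * Q m x \<partial>M') = (\<integral>x. h x * P k x * Q m x \<partial>M)" if "k < N" "m < N" for k m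
    using int'[of k "\<lambda>x. h x * Q m x"] eq'[of k "\<lambda>x. h x * Q m x"] int[OF that] that
    by (simp_all add: mult_ac)
  define b where "b k m = (\<integral>x. h x * P k x * Q m x \<partial>M)" for k m
  have F_int: "integrable M' (\<lambda>t. F k j t * Q m t)"
    "(\<integral>t. F k j t * Q m t \<partial>M') = (if j = k then b k m else if j = m then 1 else 0)"
    if "j < N" "m < N" for k j m
    using that PQ[of j m] hPQ[of j m] by (cases "j = k"; simp add: F_def b_def)+
  let ?D = "\<lambda>k x. Determinant.det (Matrix.mat N N (\<lambda>(i, j). F k j (x i)))
     * Determinant.det (Matrix.mat N N (\<lambda>(i, j). Q j (x i)))"
  have sets: "sets M' = sets borel" using be' by (simp add: biorthogonal_ensemble_def)
  have "(\<integral>x. (\<Sum>i<N. h (x i)) \<partial>be_law N M P Q)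
      = (\<integral>x. be_weight N P Q x *\<^sub>R (\<Sum>i<N. h (x i)) \<partial>PiM {..<N} (\<lambda>_. M'))"
    unfolding law[symmetric]
    by (intro integral_be_law be' borel_measurable_sum
        measurable_compose[OF measurable_component_real[OF sets] h]) auto
  also have "\<dots> = (\<integral>x. 1 / fact N * (\<Sum>k<N. ?D k x) \<partial>PiM {..<N} (\<lambda>_. M'))"
    unfolding F_def sum_distrib_right[symmetric] sum_det_replace_column be_weight_def
    by (simp add: mult_ac)
  also have "\<dots> = 1 / fact N * (\<Sum>k<N. \<integral>x. ?D k x \<partial>PiM {..<N} (\<lambda>_. M'))"
    using Andreief(1)[of N "F _" Q] F_int(1) by (simp add: Bochner_Integration.integral_sum)
  also have "(\<Sum>k<N. \<integral>x. ?D k x \<partial>PiM {..<N} (\<lambda>_. M')) = (\<Sum>k<N. fact N * b k k)"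
  proof (intro sum.cong refl)
    fix k assume k: "k \<in> {..<N}"
    have "(\<integral>x. ?D k x \<partial>PiM {..<N} (\<lambda>_. M'))
        = fact N * Determinant.det (Matrix.mat N N (\<lambda>(j, m). \<integral>t. F k j t * Q m t \<partial>M'))"
      by (rule Andreief(2)) (rule F_int(1))
    also have "Matrix.mat N N (\<lambda>(j, m). \<integral>t. F k j t * Q m t \<partial>M')
        = Matrix.mat N N (\<lambda>(j, m). if j = k then b k m else if j = m then 1 else 0)"
      by (intro eq_matI) (simp_all add: F_int(2))
    also have "Determinant.det \<dots> = b k k" by (rule det_identity_replace_row) (use k in simp)
    finally show "(\<integral>x. ?D k x \<partial>PiM {..<N} (\<lambda>_. M')) = fact N * b k k" .
  qed
  finally show ?thesis by (simp add: b_def L2_inner_def sum_distrib_left[symmetric])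
qed

section \<open>Walks and traces of truncated banded matrices\<close>

text \<open>The entry \<open>(k, m)\<close> of the \<open>l\<close>-th power of the matrix \<open>J\<close> restricted to the index set \<open>V\<close>. It is
  also the total weight of the walks of \<open>l\<close> steps from \<open>k\<close> to \<open>m\<close> that stay in \<open>V\<close>, the weight of a
  walk being the product of the matrix entries along its steps.\<close>

primrec walk_sum :: "(nat \<Rightarrow> nat \<Rightarrow> real) \<Rightarrow> nat set \<Rightarrow> nat \<Rightarrow> nat \<Rightarrow> nat \<Rightarrow> real" where
  "walk_sum J V 0 k m = (if k = m then 1 else 0)"
| "walk_sum J V (Suc l) k m = (\<Sum>j\<in>V. J k j * walk_sum J V l j m)"

text \<open>The walk starts in \<open>k\<close>, visits the vertices in the list, and ends in \<open>m\<close>; a list of length \<open>l\<close>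
  thus encodes a walk of \<open>l + 1\<close> steps.\<close>

primrec walk_weight :: "(nat \<Rightarrow> nat \<Rightarrow> real) \<Rightarrow> nat \<Rightarrow> nat list \<Rightarrow> nat \<Rightarrow> real" where
  "walk_weight J k [] m = J k m"
| "walk_weight J k (j # js) m = J k j * walk_weight J j js m"

lemma walk_sum_eq_sum_weights:
  assumes "finite V" "m \<in> V"
  shows "walk_sum J V (Suc l) k m = (\<Sum>js | set js \<subseteq> V \<and> length js = l. walk_weight J k js m)"
proof (induction l arbitrary: k)
  case 0
  have "{js. set js \<subseteq> V \<and> length js = 0} = {[]}" by auto
  then show ?case using assms by (simp add: if_distrib[of "\<lambda>x. _ * x"] cong: if_cong)
next
  case (Suc l)
  have "{js. set js \<subseteq> V \<and> length js = Suc l}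
      = (\<lambda>(j, js). j # js) ` (V \<times> {js. set js \<subseteq> V \<and> length js = l})"
    by (auto simp: length_Suc_conv image_iff)
  moreover have "inj_on (\<lambda>(j, js). j # js) X" for X :: "(nat \<times> nat list) set"
    by (auto simp: inj_on_def)
  ultimately have "(\<Sum>js | set js \<subseteq> V \<and> length js = Suc l. walk_weight J k js m)
      = sum ((\<lambda>js. walk_weight J k js m) \<circ> (\<lambda>(j, js). j # js))
          (V \<times> {js. set js \<subseteq> V \<and> length js = l})"
    by (simp only: sum.reindex)
  also have "\<dots> = (\<Sum>(j, js)\<in>V \<times> {js. set js \<subseteq> V \<and> length js = l}. walk_weight J k (j # js) m)"
    by (intro sum.cong) auto
  also have "\<dots> = (\<Sum>j\<in>V. J k j * (\<Sum>js | set js \<subseteq> V \<and> length js = l. walk_weight J j js m))"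
    by (simp add: sum.cartesian_product[symmetric] sum_distrib_left)
  also have "\<dots> = walk_sum J V (Suc (Suc l)) k m" by (simp only: Suc.IH walk_sum.simps(2)[of J V "Suc l"])
  finally show ?case by simp
qed

text \<open>Every step of a walk with nonzero weight goes up by at most \<open>q\<close>, although it can go down
  arbitrarily far.\<close>

lemma walk_weight_nonzero_bounds:
  assumes J: "\<And>k m. m > k + q \<Longrightarrow> J k m = 0" and "walk_weight J k js m \<noteq> 0"
  shows "m \<le> k + (length js + 1) * q"
    and "j \<in> set js \<Longrightarrow> j \<le> k + length js * q \<and> m \<le> j + length js * q"
  using assms(2)
proof (induction js arbitrary: k)
  case Nil
  { case 1 then show ?case using J[of k m] by (cases "k + q < m") auto }
  { case 2 then show ?case by simp }
next
  case (Cons i js)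
  have step: "i \<le> k + q" if "J k i \<noteq> 0" for k
    using J[of k i] that by (cases "k + q < i") auto
  { case 1
    then have nz: "J k i \<noteq> 0" "walk_weight J i js m \<noteq> 0" by simp_all
    from step[OF nz(1)] Cons.IH(1)[OF nz(2)] show ?case by (simp add: algebra_simps) }
  { case 2
    then have nz: "J k i \<noteq> 0" "walk_weight J i js m \<noteq> 0" by simp_all
    from 2(1) step[OF nz(1)] Cons.IH(1)[OF nz(2)] Cons.IH(2)[OF _ nz(2)]
    show ?case by (auto simp: algebra_simps) }
qed

lemma abs_walk_weight_le:
  assumes "\<And>i j. i \<in> I \<Longrightarrow> j \<in> I \<Longrightarrow> \<bar>J i j\<bar> \<le> C" and "k \<in> I" "m \<in> I" "set js \<subseteq> I"
  shows "\<bar>walk_weight J k js m\<bar> \<le> C ^ (length js + 1)"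
  using assms(2,4)
proof (induction js arbitrary: k)
  case Nil
  then show ?case using assms(1,3) by simp
next
  case (Cons i js)
  then have "\<bar>J k i\<bar> * \<bar>walk_weight J i js m\<bar> \<le> C * C ^ (length js + 1)"
    using assms(1)[of k i] by (intro mult_mono) auto
  then show ?case by (simp add: abs_mult)
qed

text \<open>Both traces are sums over closed walks starting below \<open>N\<close>, so their difference is carried by the
  closed walks that start below \<open>N\<close> and reach some vertex above. Since steps go up by at most \<open>q\<close>,
  reaching such a vertex forces the start to be at least \<open>N - l * q\<close>, and returning to the start
  forces every visited vertex to lie within distance \<open>2 * Suc l * q\<close> of \<open>N\<close>. Counting the walks in
  this window and bounding each step by \<open>C\<close> gives the estimate.\<close>

lemma trace_truncation_error:
  assumes J: "\<And>k m. m > k + q \<Longrightarrow> J k m = 0"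
    and W: "finite W" "{..<N} \<subseteq> W"
    and C: "\<And>i j. N \<le> i + 2 * Suc l * q \<Longrightarrow> i \<le> N + 2 * Suc l * q
      \<Longrightarrow> N \<le> j + 2 * Suc l * q \<Longrightarrow> j \<le> N + 2 * Suc l * q \<Longrightarrow> \<bar>J i j\<bar> \<le> C"
  shows "\<bar>(\<Sum>k<N. walk_sum J W (Suc l) k k) - (\<Sum>k<N. walk_sum J {..<N} (Suc l) k k)\<bar>
    \<le> (real (4 * Suc l * q + 1) * C) ^ Suc l"
proof -
  define R where "R = 2 * Suc l * q"
  define I where "I = {j. N \<le> j + R \<and> j \<le> N + R}"
  let ?L = "\<lambda>V. {js. set js \<subseteq> V \<and> length js = l}"
  define B where "B = {..<N} \<times> (?L W - ?L {..<N})"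
  have I: "I \<subseteq> {N - R..N + R}" unfolding I_def by auto
  then have fin_I: "finite I" by (rule finite_subset) simp
  have "card I \<le> card {N - R..N + R}" by (rule card_mono[OF _ I]) simp
  also have "\<dots> \<le> 2 * R + 1" by simp
  finally have card_I: "card I \<le> 4 * Suc l * q + 1" by (simp add: R_def algebra_simps)
  have fin: "finite (?L V)" if "finite V" for V :: "nat set" by (rule finite_lists_length_eq[OF that])
  have "(\<Sum>k<N. walk_sum J W (Suc l) k k) - (\<Sum>k<N. walk_sum J {..<N} (Suc l) k k)
      = (\<Sum>k<N. (\<Sum>js\<in>?L W. walk_weight J k js k) - (\<Sum>js\<in>?L {..<N}. walk_weight J k js k))"
    unfolding sum_subtractf[symmetric]
  proof (rule sum.cong[OF refl])
    fix k assume "k \<in> {..<N}"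
    then show "walk_sum J W (Suc l) k k - walk_sum J {..<N} (Suc l) k k
        = (\<Sum>js\<in>?L W. walk_weight J k js k) - (\<Sum>js\<in>?L {..<N}. walk_weight J k js k)"
      using W by (subst (1 2) walk_sum_eq_sum_weights) auto
  qed
  also have "\<dots> = (\<Sum>k<N. \<Sum>js\<in>?L W - ?L {..<N}. walk_weight J k js k)"
    using W by (intro sum.cong refl sum_diff[symmetric] fin) auto
  also have "\<dots> = (\<Sum>(k, js)\<in>B. walk_weight J k js k)"
    unfolding B_def by (rule sum.cartesian_product)
  also have "\<dots> = (\<Sum>(k, js)\<in>B \<inter> I \<times> ?L I. walk_weight J k js k)"
  proof (rule sum.mono_neutral_right)
    show "finite B" using W fin by (auto simp: B_def)
    show "\<forall>i\<in>B - B \<inter> I \<times> ?L I. (case i of (k, js) \<Rightarrow> walk_weight J k js k) = 0"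
    proof (rule ballI, rule ccontr)
      fix x assume x: "x \<in> B - B \<inter> I \<times> ?L I" "(case x of (k, js) \<Rightarrow> walk_weight J k js k) \<noteq> 0"
      obtain k js where "x = (k, js)" by (cases x)
      with x have kjs: "(k, js) \<in> B" "(k, js) \<notin> I \<times> ?L I" "walk_weight J k js k \<noteq> 0"
        by simp_all
      then obtain h where h: "k < N" "length js = l" "h \<in> set js" "h \<ge> N"
        by (fastforce simp: B_def)
      have b: "j \<le> k + length js * q \<and> k \<le> j + length js * q" if "j \<in> set js" for j
        using walk_weight_nonzero_bounds(2)[of q J k js k j] J kjs(3) that by blast
      have "N \<le> k + l * q" using b[OF h(3)] h by simp
      then have "k \<in> I" using h by (simp add: I_def R_def algebra_simps)
      moreover have "j \<in> I" if "j \<in> set js" for j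
        using b[OF that] h \<open>N \<le> k + l * q\<close> by (simp add: I_def R_def algebra_simps)
      ultimately show False using kjs(2) h by auto
    qed
  qed auto
  finally have "\<bar>(\<Sum>k<N. walk_sum J W (Suc l) k k) - (\<Sum>k<N. walk_sum J {..<N} (Suc l) k k)\<bar>
      = \<bar>\<Sum>(k, js)\<in>B \<inter> I \<times> ?L I. walk_weight J k js k\<bar>" by simp
  also have "\<dots> \<le> (\<Sum>(k, js)\<in>B \<inter> I \<times> ?L I. \<bar>walk_weight J k js k\<bar>)"
    unfolding case_prod_beta by (rule sum_abs)
  also have "\<dots> \<le> (\<Sum>(k, js)\<in>I \<times> ?L I. \<bar>walk_weight J k js k\<bar>)"
    using fin_I fin by (intro sum_mono2) auto
  also have "\<dots> \<le> (\<Sum>_\<in>I \<times> ?L I. C ^ Suc l)"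
  proof (rule sum_mono, clarsimp)
    fix k js assume *: "k \<in> I" "set js \<subseteq> I" "l = length js"
    show "\<bar>walk_weight J k js k\<bar> \<le> C * C ^ length js"
      using abs_walk_weight_le[of I J C k k js] C * unfolding I_def R_def by auto
  qed
  also have "\<dots> = (real (card I) * C) ^ Suc l"
    using card_lists_length_eq[OF fin_I, of l] by (simp add: card_cartesian_product power_mult_distrib)
  also have "\<dots> \<le> (real (4 * Suc l * q + 1) * C) ^ Suc l"
  proof (rule power_mono)
    have "C \<ge> 0" using order_trans[OF abs_ge_zero C[of N N]] by simp
    then show "0 \<le> real (card I) * C" "real (card I) * C \<le> real (4 * Suc l * q + 1) * C"
      using card_I by (auto intro!: mult_right_mono simp del: of_nat_Suc of_nat_mult of_nat_add)
  qed
  finally show ?thesis .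
qed

section \<open>Power sums of eigenvalues\<close>

lemma trace_mult_commute:
  fixes A B :: "'a::comm_semiring_0 mat"
  assumes A: "A \<in> carrier_mat n n" and B: "B \<in> carrier_mat n n"
  shows "(\<Sum>i<n. (A * B) $$ (i, i)) = (\<Sum>i<n. (B * A) $$ (i, i))"
proof -
  have "(\<Sum>i<n. (A * B) $$ (i, i)) = (\<Sum>i<n. \<Sum>j<n. A $$ (i, j) * B $$ (j, i))"
    using assms by (intro sum.cong) (auto simp: scalar_prod_def atLeast0LessThan)
  also have "\<dots> = (\<Sum>j<n. \<Sum>i<n. B $$ (j, i) * A $$ (i, j))"
    by (subst sum.swap) (simp add: mult.commute)
  also have "\<dots> = (\<Sum>j<n. (B * A) $$ (j, j))"
    using assms by (intro sum.cong) (auto simp: scalar_prod_def atLeast0LessThan)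
  finally show ?thesis .
qed

lemma upper_triangular_mult:
  fixes A B :: "'a::comm_semiring_1 mat"
  assumes A: "A \<in> carrier_mat n n" "upper_triangular A" and B: "B \<in> carrier_mat n n" "upper_triangular B"
  shows "upper_triangular (A * B)" and "i < n \<Longrightarrow> (A * B) $$ (i, i) = A $$ (i, i) * B $$ (i, i)"
proof -
  have entry: "(A * B) $$ (i, j) = (\<Sum>k<n. A $$ (i, k) * B $$ (k, j))" if "i < n" "j < n" for i j
    using A B that by (auto simp: scalar_prod_def atLeast0LessThan)
  have A0: "A $$ (i, j) = 0" and B0: "B $$ (i, j) = 0" if "j < i" "i < n" for i j
    using A B that by auto
  show "upper_triangular (A * B)"
  proof (rule upper_triangularI)
    fix i j assume "j < i" "i < dim_row (A * B)"
    then have ij: "j < i" "i < n" "j < n" using A by auto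
    have "A $$ (i, k) * B $$ (k, j) = 0" if "k < n" for k
      using A0[of k i] B0[of j k] ij that by (cases "k < i") auto
    then show "(A * B) $$ (i, j) = 0" using ij by (simp add: entry)
  qed
  assume i: "i < n"
  have "A $$ (i, k) * B $$ (k, i) = (if k = i then A $$ (i, i) * B $$ (i, i) else 0)" if "k < n" for k
    using A0[of k i] B0[of i k] i that by (cases "k < i"; cases "i < k") auto
  then have "(\<Sum>k<n. A $$ (i, k) * B $$ (k, i)) = (\<Sum>k<n. if k = i then A $$ (i, i) * B $$ (i, i) else 0)"
    by (intro sum.cong refl) (simp only: lessThan_iff)
  then show "(A * B) $$ (i, i) = A $$ (i, i) * B $$ (i, i)" using i unfolding entry[OF i i] by simp
qed

lemma upper_triangular_pow:
  fixes A :: "'a::comm_semiring_1 mat"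
  assumes A: "A \<in> carrier_mat n n" "upper_triangular A"
  shows "upper_triangular (A ^\<^sub>m l) \<and> (\<forall>i<n. (A ^\<^sub>m l) $$ (i, i) = (A $$ (i, i)) ^ l)"
proof (induction l)
  case 0
  then show ?case using A by auto
next
  case (Suc l)
  have "A ^\<^sub>m l \<in> carrier_mat n n" using A by simp
  then show ?case
    using upper_triangular_mult[OF _ _ A, of "A ^\<^sub>m l"] Suc by (simp add: mult.commute)
qed

text \<open>By Schur's theorem \<open>A\<close> is similar to a triangular matrix with diagonal \<open>es\<close>, and the trace is
  invariant under similarity.\<close>

lemma trace_pow_eq_sum_roots:
  fixes A :: "complex mat"
  assumes A: "A \<in> carrier_mat n n" and roots: "char_poly A = (\<Prod>e\<leftarrow>es. [:- e, 1:])"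
  shows "(\<Sum>i<n. (A ^\<^sub>m l) $$ (i, i)) = (\<Sum>e\<leftarrow>es. e ^ l)"
proof -
  obtain B P Q where "schur_decomposition A es = (B, P, Q)" by (cases "schur_decomposition A es") auto
  from schur_decomposition[OF A roots this]
  have sim: "similar_mat_wit A B P Q" and tri: "upper_triangular B" and diag: "diag_mat B = es" by auto
  note carr = similar_mat_witD2[OF A sim]
  have pow: "A ^\<^sub>m l = P * B ^\<^sub>m l * Q" by (rule similar_mat_wit_pow_id[OF sim])
  have Bl: "B ^\<^sub>m l \<in> carrier_mat n n" using carr by simp
  have "(\<Sum>i<n. (A ^\<^sub>m l) $$ (i, i)) = (\<Sum>i<n. (Q * (P * B ^\<^sub>m l)) $$ (i, i))"
    unfolding pow using carr Bl by (intro trace_mult_commute) auto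
  also have "Q * (P * B ^\<^sub>m l) = (Q * P) * B ^\<^sub>m l"
    by (rule assoc_mult_mat[symmetric, of Q n n P n "B ^\<^sub>m l" n]) (use carr Bl in auto)
  also have "\<dots> = B ^\<^sub>m l" using carr Bl by simp
  also have "(\<Sum>i<n. (B ^\<^sub>m l) $$ (i, i)) = (\<Sum>i<n. (B $$ (i, i)) ^ l)"
    using upper_triangular_pow[of B n l] carr tri by simp
  also have "\<dots> = (\<Sum>e\<leftarrow>es. e ^ l)"
    unfolding diag[symmetric] diag_mat_def using carr
    by (simp add: o_def interv_sum_list_conv_sum_set_nat atLeast0LessThan)
  finally show ?thesis .
qed

lemma pow_mat_Suc_left:
  fixes A :: "'a::semiring_1 mat"
  assumes A: "A \<in> carrier_mat n n"
  shows "A ^\<^sub>m Suc l = A * A ^\<^sub>m l"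
proof (induction l)
  case (Suc l)
  have "A ^\<^sub>m Suc (Suc l) = (A * A ^\<^sub>m l) * A" by (simp only: pow_mat.simps(2)[of A "Suc l"] Suc)
  also have "\<dots> = A * (A ^\<^sub>m l * A)" using A by (intro assoc_mult_mat[of _ n n _ n _ n]) auto
  finally show ?case by simp
qed (use A in simp)

definition truncation :: "nat \<Rightarrow> (nat \<Rightarrow> nat \<Rightarrow> real) \<Rightarrow> complex mat" where
  "truncation N J = Matrix.mat N N (\<lambda>(k, m). complex_of_real (J k m))"

lemma truncation_carrier [simp]: "truncation N J \<in> carrier_mat N N"
  by (simp add: truncation_def)

lemma truncation_pow_entry:
  assumes "k < N" "m < N"
  shows "(truncation N J ^\<^sub>m l) $$ (k, m) = complex_of_real (walk_sum J {..<N} l k m)"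
  using assms
proof (induction l arbitrary: k)
  case 0
  then show ?case by (simp add: truncation_def)
next
  case (Suc l)
  have "truncation N J ^\<^sub>m l \<in> carrier_mat N N" by simp
  then have "(truncation N J ^\<^sub>m Suc l) $$ (k, m)
      = (\<Sum>j<N. truncation N J $$ (k, j) * (truncation N J ^\<^sub>m l) $$ (j, m))"
    unfolding pow_mat_Suc_left[OF truncation_carrier] using Suc.prems
    by (subst index_mult_mat) (auto simp: scalar_prod_def atLeast0LessThan truncation_def)
  also have "\<dots> = (\<Sum>j<N. complex_of_real (J k j) * complex_of_real (walk_sum J {..<N} l j m))"
    using Suc by (intro sum.cong) (auto simp: truncation_def)
  finally show ?case by simp
qed

lemma poly_char_poly_truncation:
  "poly (char_poly (truncation N J)) z
    = Determinant.det (Matrix.mat N N (\<lambda>(k, m). (if k = m then z else 0) - complex_of_real (J k m)))"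
  unfolding char_poly_matrix[OF truncation_carrier]
  by (intro arg_cong[where f=Determinant.det] eq_matI) (auto simp: char_matrix_def truncation_def)

lemma proots_prod_linear_factors: "proots (\<Prod>a\<leftarrow>as. [:- a, 1:]) = mset (as :: 'a::field list)"
proof (induction as)
  case (Cons a as)
  have "(\<Prod>a\<leftarrow>as. [:- a, 1:]) \<noteq> 0" by (auto simp: prod_list_zero_iff)
  then have "proots ([:- a, 1:] * (\<Prod>a\<leftarrow>as. [:- a, 1:])) = proots [:- a, 1:] + proots (\<Prod>a\<leftarrow>as. [:- a, 1:])"
    by (intro proots_mult) simp_all
  then show ?case using Cons by simp
qed simp

section \<open>Multiplication by x in a biorthogonal system\<close>

text \<open>One level of the structural assumption, that is, the measure and the two families for one fixed
  \<open>N\<close>.\<close>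

locale banded_biorthogonal_system =
  fixes M :: "real measure" and P Q :: "nat \<Rightarrow> real \<Rightarrow> real" and q :: nat
  assumes sets_M: "sets M = sets borel"
    and P_L2: "in_L2 M (P k)" and Q_L2: "in_L2 M (Q k)"
    and biorthogonal: "L2_inner M (P k) (Q m) = (if k = m then 1 else 0)"
    and recurrence: "\<exists>c. AE x in M. x * P k x = (\<Sum>m\<le>k + q. c m * P m x)"
begin

text \<open>The matrix of the multiplication by \<open>x\<close>; its row \<open>k\<close> contains the coordinates of \<open>x P k\<close>.\<close>

definition mult_coeff :: "nat \<Rightarrow> nat \<Rightarrow> real" where
  "mult_coeff k m = L2_inner M (\<lambda>x. x * P k x) (Q m)"

lemma P_measurable [measurable]: "P k \<in> borel_measurable M"
  using P_L2 by (simp add: in_L2_def)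

lemma Q_measurable [measurable]: "Q k \<in> borel_measurable M"
  using Q_L2 by (simp add: in_L2_def)

lemma measurable_M: "borel_measurable borel = borel_measurable M"
  by (rule measurable_cong_sets) (simp_all add: sets_M)

lemma expansion_coefficient:
  assumes f [measurable]: "f \<in> borel_measurable M" and "finite A"
    and f_eq: "AE x in M. f x = (\<Sum>j\<in>A. c j * P j x)"
  shows "integrable M (\<lambda>x. f x * Q m x)" and "L2_inner M f (Q m) = (if m \<in> A then c m else 0)"
proof -
  have eq: "AE x in M. f x * Q m x = (\<Sum>j\<in>A. c j * (P j x * Q m x))"
    using f_eq by eventually_elim (simp add: sum_distrib_right mult.assoc)
  have int: "integrable M (\<lambda>x. P j x * Q m x)" for j by (rule integrable_mult_in_L2[OF P_L2 Q_L2])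
  have int_sum: "integrable M (\<lambda>x. \<Sum>j\<in>A. c j * (P j x * Q m x))" using int by simp
  show "integrable M (\<lambda>x. f x * Q m x)"
    by (subst integrable_cong_AE[OF _ _ eq]) (use int_sum in auto)
  have "L2_inner M f (Q m) = (\<integral>x. (\<Sum>j\<in>A. c j * (P j x * Q m x)) \<partial>M)"
    unfolding L2_inner_def by (rule integral_cong_AE[OF _ _ eq]) measurable
  also have "\<dots> = (\<Sum>j\<in>A. c j * L2_inner M (P j) (Q m))"
    using int by (simp add: L2_inner_def)
  also have "\<dots> = (if m \<in> A then c m else 0)"
    using \<open>finite A\<close> by (simp add: biorthogonal if_distrib[of "\<lambda>x. _ * x"] cong: if_cong)
  finally show "L2_inner M f (Q m) = (if m \<in> A then c m else 0)" .
qed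

lemma id_measurable [measurable]: "(\<lambda>x. x) \<in> borel_measurable M"
  by (simp add: measurable_M[symmetric])

lemma mult_coeff_eq_0: "m > k + q \<Longrightarrow> mult_coeff k m = 0"
  and mult_coeff_expansion: "AE x in M. x * P k x = (\<Sum>m\<le>k + q. mult_coeff k m * P m x)"
proof -
  obtain c where c: "AE x in M. x * P k x = (\<Sum>m\<le>k + q. c m * P m x)" using recurrence by blast
  have mult_coeff: "mult_coeff k m = (if m \<in> {..k + q} then c m else 0)" for m
    unfolding mult_coeff_def by (rule expansion_coefficient(2)[OF _ _ c]) auto
  show "m > k + q \<Longrightarrow> mult_coeff k m = 0" by (simp add: mult_coeff)
  show "AE x in M. x * P k x = (\<Sum>m\<le>k + q. mult_coeff k m * P m x)"
    using c by eventually_elim (auto simp: mult_coeff intro!: sum.cong)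
qed

text \<open>From row \<open>k\<close>, at most \<open>l\<close> steps upwards by \<open>q\<close> are taken, so the infinite matrix may be cut off at
  \<open>L\<close> without changing the first \<open>l\<close> powers in that row.\<close>

lemma power_expansion:
  assumes "k + l * q \<le> L"
  shows "AE x in M. x ^ l * P k x = (\<Sum>m\<le>L. walk_sum mult_coeff {..L} l k m * P m x)"
  using assms
proof (induction l arbitrary: k)
  case 0
  then show ?case by (simp add: if_distrib[of "\<lambda>x. x * _"] cong: if_cong)
next
  case (Suc l)
  have "AE x in M. \<forall>j\<in>{..k + q}. x ^ l * P j x = (\<Sum>m\<le>L. walk_sum mult_coeff {..L} l j m * P m x)"
    using Suc by (intro AE_finite_allI) (auto simp: algebra_simps)
  then show ?case using mult_coeff_expansion[of k]
  proof eventually_elim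
    case (elim x)
    have "x ^ Suc l * P k x = x ^ l * (x * P k x)" by simp
    also have "\<dots> = (\<Sum>j\<le>k + q. mult_coeff k j * (x ^ l * P j x))"
      unfolding elim(2) by (simp add: sum_distrib_left mult_ac)
    also have "\<dots> = (\<Sum>j\<le>k + q. mult_coeff k j * (\<Sum>m\<le>L. walk_sum mult_coeff {..L} l j m * P m x))"
      using elim(1) by (intro sum.cong) auto
    also have "\<dots> = (\<Sum>j\<le>L. mult_coeff k j * (\<Sum>m\<le>L. walk_sum mult_coeff {..L} l j m * P m x))"
      using Suc.prems by (intro sum.mono_neutral_left) (auto simp: mult_coeff_eq_0)
    also have "\<dots> = (\<Sum>m\<le>L. walk_sum mult_coeff {..L} (Suc l) k m * P m x)"
      unfolding sum_distrib_left by (subst sum.swap) (simp add: sum_distrib_right mult.assoc)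
    finally show ?case .
  qed
qed

lemma power_coefficient:
  assumes "k + l * q \<le> L" "m \<le> L"
  shows "integrable M (\<lambda>x. x ^ l * P k x * Q m x)"
    and "L2_inner M (\<lambda>x. x ^ l * P k x) (Q m) = walk_sum mult_coeff {..L} l k m"
  using expansion_coefficient[OF _ _ power_expansion[OF assms(1)], of m] assms(2) by auto

lemma integrable_power: "integrable M (\<lambda>x. x ^ l * P k x * Q m x)"
  by (rule power_coefficient(1)[where L="k + l * q + m"]) auto

lemma expected_empirical_moment:
  assumes be: "biorthogonal_ensemble N M P Q" and N: "N \<ge> 1"
  shows "(\<integral>x. (\<integral>t. t ^ l \<partial>empirical_points N x) \<partial>be_law N M P Q)
    = (\<Sum>k<N. walk_sum mult_coeff {..N + l * q} l k k) / real N"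
proof -
  have "(\<integral>x. (\<integral>t. t ^ l \<partial>empirical_points N x) \<partial>be_law N M P Q)
      = (\<integral>x. (\<Sum>i<N. x i ^ l) \<partial>be_law N M P Q) / real N"
    by (simp add: integral_empirical_points[OF N])
  also have "(\<integral>x. (\<Sum>i<N. x i ^ l) \<partial>be_law N M P Q) = (\<Sum>k<N. L2_inner M (\<lambda>x. x ^ l * P k x) (Q k))"
    by (rule expectation_linear_statistic[OF be]) (auto intro: integrable_power)
  also have "\<dots> = (\<Sum>k<N. walk_sum mult_coeff {..N + l * q} l k k)"
    by (intro sum.cong power_coefficient(2)) auto
  finally show ?thesis .
qed

lemma zeros_of_avg_char:
  assumes be: "biorthogonal_ensemble N M P Q"
  obtains es where "length es = N"
    and "zeros_distribution N (be_law N M P Q) = empirical_measure (mset es)"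
    and "\<And>e. e \<in> set es \<Longrightarrow> avg_char N (be_law N M P Q) e = 0"
    and "\<And>l. (\<Sum>e\<leftarrow>es. e ^ l) = complex_of_real (\<Sum>k<N. walk_sum mult_coeff {..<N} l k k)"
proof -
  let ?A = "truncation N mult_coeff"
  have eq: "avg_char N (be_law N M P Q) z = poly (char_poly ?A) z" for z
    unfolding poly_char_poly_truncation mult_coeff_def
    by (rule avg_char_be_law[OF be]) (use integrable_power[of 1] in simp)
  have poly: "avg_char_poly N (be_law N M P Q) = char_poly ?A"
    unfolding avg_char_poly_def eq by (rule the_equality) (auto simp: poly_eq_poly_eq_iff fun_eq_iff[symmetric])
  obtain es where es: "char_poly ?A = (\<Prod>e\<leftarrow>es. [:- e, 1:])" "length es = N"
    using char_poly_factorized[OF truncation_carrier[of N mult_coeff]] by blast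
  show ?thesis
  proof (rule that[OF es(2)])
    show "zeros_distribution N (be_law N M P Q) = empirical_measure (mset es)"
      unfolding zeros_distribution_def poly es(1) proots_prod_linear_factors ..
    show "avg_char N (be_law N M P Q) e = 0" if "e \<in> set es" for e
      unfolding eq es(1) using that by (auto simp: poly_prod_list prod_list_zero_iff)
    show "(\<Sum>e\<leftarrow>es. e ^ l) = complex_of_real (\<Sum>k<N. walk_sum mult_coeff {..<N} l k k)" for l
      unfolding trace_pow_eq_sum_roots[OF truncation_carrier es(1), symmetric]
      by (simp add: truncation_pow_entry)
  qed
qed

end

section \<open>Convergence of the zeros\<close>

text \<open>With \<open>q\<close> and \<open>C\<close> both below \<open>N powr (1 / (4 * s))\<close>, the numerator is
  bounded by a constant multiple of \<open>N powr (1 / 2)\<close>.\<close>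

lemma subpolynomial_product_negligible:
  fixes q :: "nat \<Rightarrow> nat" and C :: "nat \<Rightarrow> real"
  assumes q: "\<And>n::nat. n \<ge> 1 \<Longrightarrow> (\<lambda>N. real (q N)) \<in> o(\<lambda>N. real N powr (1 / real n))"
    and C: "\<And>n::nat. n \<ge> 1 \<Longrightarrow> C \<in> o(\<lambda>N. real N powr (1 / real n))"
    and s: "s \<ge> 1"
  shows "(\<lambda>N. (real (4 * s * q N + 1) * C N) ^ s / real N) \<longlonglongrightarrow> 0"
proof (rule Lim_null_comparison)
  define a where "a = 1 / real (4 * s)"
  have "\<forall>\<^sub>F N in sequentially. norm (real (q N)) \<le> 1 * norm (real N powr a)"
    unfolding a_def by (rule landau_o.smallD[OF q]) (use s in auto)
  moreover have "\<forall>\<^sub>F N in sequentially. norm (C N) \<le> 1 * norm (real N powr a)"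
    unfolding a_def by (rule landau_o.smallD[OF C]) (use s in auto)
  ultimately show "\<forall>\<^sub>F N in sequentially. norm ((real (4 * s * q N + 1) * C N) ^ s / real N)
      \<le> real (4 * s + 1) ^ s * real N powr (- 1 / 2)"
    using eventually_ge_at_top[of 1]
  proof eventually_elim
    case (elim N)
    then have one: "1 \<le> real N powr a" by (intro ge_one_powr_ge_zero) (auto simp: a_def)
    have "real (4 * s * q N + 1) = real (4 * s) * real (q N) + 1" by simp
    also have "\<dots> \<le> real (4 * s) * real N powr a + real N powr a"
      using elim(1) one by (intro add_mono mult_left_mono) auto
    also have "\<dots> = real (4 * s + 1) * real N powr a" by (simp add: algebra_simps)
    finally have "real (4 * s * q N + 1) * \<bar>C N\<bar> \<le> (real (4 * s + 1) * real N powr a) * real N powr a"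
      using elim(2) by (intro mult_mono) auto
    then have "(real (4 * s * q N + 1) * \<bar>C N\<bar>) ^ s \<le> ((real (4 * s + 1) * real N powr a) * real N powr a) ^ s"
      by (rule power_mono) simp
    also have "\<dots> = real (4 * s + 1) ^ s * (real N powr a * real N powr a) ^ s"
      by (simp only: mult.assoc power_mult_distrib)
    also have "(real N powr a * real N powr a) ^ s = real N powr (1 / 2)"
    proof -
      have "(real N powr a * real N powr a) ^ s = real N powr (real s * (a + a))"
        using elim(3) by (simp add: powr_add[symmetric] powr_power mult.commute)
      also have "real s * (a + a) = 1 / 2" using s by (simp add: a_def field_simps)
      finally show ?thesis .
    qed
    finally have "(real (4 * s * q N + 1) * \<bar>C N\<bar>) ^ s / real N
        \<le> real (4 * s + 1) ^ s * real N powr (1 / 2) / real N"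
      by (rule divide_right_mono) simp
    also have "\<dots> = real (4 * s + 1) ^ s * real N powr (- 1 / 2)"
      using elim(3) powr_diff[of "real N" "1 / 2" 1] by simp
    finally show ?case
      by (simp add: abs_mult power_abs norm_divide norm_power)
  qed
  show "(\<lambda>N. real (4 * s + 1) ^ s * real N powr (- 1 / 2)) \<longlonglongrightarrow> 0"
    by (intro tendsto_mult_right_zero tendsto_neg_powr filterlim_real_sequentially) auto
qed

text \<open>For large \<open>N\<close>, the window of width proportional to \<open>q N\<close> around \<open>N\<close> in which the truncation error
  lives is contained in the set of indices \<open>k\<close> with \<open>\<bar>k / N - 1\<bar> \<le> \<epsilon>\<close>, where the matrix entries
  are bounded by \<open>C \<epsilon> N\<close>.\<close>

lemma walk_sum_difference_negligible:
  fixes J :: "nat \<Rightarrow> nat \<Rightarrow> nat \<Rightarrow> real" and q :: "nat \<Rightarrow> nat"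
  defines "C \<equiv> \<lambda>\<epsilon> N. Max ((\<lambda>(k, m). \<bar>J N k m\<bar>) `
      {(k, m). \<bar>real k / real N - 1\<bar> \<le> \<epsilon> \<and> \<bar>real m / real N - 1\<bar> \<le> \<epsilon>})"
  assumes band: "\<And>N k m. N \<ge> 1 \<Longrightarrow> m > k + q N \<Longrightarrow> J N k m = 0"
    and q: "\<And>n::nat. n \<ge> 1 \<Longrightarrow> (\<lambda>N. real (q N)) \<in> o(\<lambda>N. real N powr (1 / real n))"
    and \<epsilon>: "\<epsilon> > 0"
    and C: "\<And>n::nat. n \<ge> 1 \<Longrightarrow> C \<epsilon> \<in> o(\<lambda>N. real N powr (1 / real n))"
  shows "(\<lambda>N. (\<Sum>k<N. walk_sum (J N) {..N + l * q N} l k k) / real N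
    - (\<Sum>k<N. walk_sum (J N) {..<N} l k k) / real N) \<longlonglongrightarrow> 0"
proof (cases l)
  case 0
  then show ?thesis by simp
next
  case (Suc s)
  show ?thesis
  proof (rule Lim_null_comparison)
    show "(\<lambda>N. (real (4 * Suc s * q N + 1) * C \<epsilon> N) ^ Suc s / real N) \<longlonglongrightarrow> 0"
      by (rule subpolynomial_product_negligible[OF q C]) simp_all
    have "\<forall>\<^sub>F N in sequentially. norm (real (q N)) \<le> \<epsilon> / real (2 * Suc s) * norm (real N powr (1 / real 1))"
      by (rule landau_o.smallD[OF q]) (use \<epsilon> in auto)
    then show "\<forall>\<^sub>F N in sequentially. norm ((\<Sum>k<N. walk_sum (J N) {..N + l * q N} l k k) / real N
        - (\<Sum>k<N. walk_sum (J N) {..<N} l k k) / real N)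
      \<le> (real (4 * Suc s * q N + 1) * C \<epsilon> N) ^ Suc s / real N"
      using eventually_ge_at_top[of 1]
    proof eventually_elim
      case (elim N)
      \<comment> \<open>Half the width of the window in \<open>trace_truncation_error\<close>.\<close>
      define R where "R = 2 * Suc s * q N"
      have R: "real R \<le> \<epsilon> * real N"
        using elim by (simp add: R_def field_simps)
      let ?K = "{k. \<bar>real k / real N - 1\<bar> \<le> \<epsilon>}"
      have near: "k \<in> ?K" if "N \<le> k + R" "k \<le> N + R" for k
      proof -
        have "\<bar>real k - real N\<bar> \<le> real R" using that by linarith
        also note R
        finally have "\<bar>real k - real N\<bar> / real N \<le> \<epsilon>" using elim(2) by (simp add: field_simps)
        moreover have "real k / real N - 1 = (real k - real N) / real N" using elim(2) by (simp add: field_simps)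
        ultimately show ?thesis by (simp add: abs_divide)
      qed
      have "k \<le> nat \<lceil>(1 + \<epsilon>) * real N\<rceil>" if "k \<in> ?K" for k
      proof -
        have "real k / real N \<le> 1 + \<epsilon>" using that by auto
        then have "real k \<le> (1 + \<epsilon>) * real N" using elim(2) by (simp add: field_simps)
        then show ?thesis by linarith
      qed
      then have "finite ?K" by (intro finite_subset[of ?K "{..nat \<lceil>(1 + \<epsilon>) * real N\<rceil>}"]) auto
      then have fin: "finite {(k, m). \<bar>real k / real N - 1\<bar> \<le> \<epsilon> \<and> \<bar>real m / real N - 1\<bar> \<le> \<epsilon>}"
        by (intro finite_subset[OF _ finite_cartesian_product[of ?K ?K]]) auto
      have bound: "\<bar>J N k m\<bar> \<le> C \<epsilon> N" if "k \<in> ?K" "m \<in> ?K" for k m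
        unfolding C_def by (rule Max_ge) (use that fin in \<open>auto intro!: image_eqI[of _ _ "(k, m)"]\<close>)
      have "\<bar>(\<Sum>k<N. walk_sum (J N) {..N + l * q N} l k k) - (\<Sum>k<N. walk_sum (J N) {..<N} l k k)\<bar>
          \<le> (real (4 * Suc s * q N + 1) * C \<epsilon> N) ^ Suc s"
        unfolding Suc
        by (rule trace_truncation_error) (use band elim(2) near bound in \<open>auto simp: R_def\<close>)
      then show ?case
        unfolding diff_divide_distrib[symmetric] real_norm_def abs_divide
        by (simp add: divide_right_mono)
    qed
  qed
qed

text \<open>Once all points are real, the empirical measure is the image of one on the real line, to which
  the method of moments applies. The finitely many indices before that are skipped by a shift.\<close>

lemma weakly_converges_of_moments:
  fixes \<mu> :: "nat \<Rightarrow> complex measure" and zs :: "nat \<Rightarrow> complex list"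
  assumes zs: "\<And>N. N \<ge> 1 \<Longrightarrow> length (zs N) = N" "\<And>N. N \<ge> 1 \<Longrightarrow> \<mu> N = empirical_measure (mset (zs N))"
    and real: "\<forall>\<^sub>F N in sequentially. set (zs N) \<subseteq> \<real>"
    and det: "characterized_by_moments \<nu>"
    and lim: "\<And>l. (\<lambda>N. Re (\<Sum>z\<leftarrow>zs N. z ^ l) / real N) \<longlonglongrightarrow> (\<integral>t. t ^ l \<partial>\<nu>)"
  shows "weakly_converges \<mu> (distr \<nu> borel complex_of_real)"
proof -
  obtain N0 where N0: "\<And>N. N \<ge> N0 \<Longrightarrow> set (zs N) \<subseteq> \<real>"
    using real by (auto simp: eventually_sequentially)
  \<comment> \<open>The successor excludes the empty list of points for \<open>N = 0\<close>.\<close>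
  define N1 where "N1 = Suc N0"
  define \<rho> where "\<rho> n = empirical_measure (mset (map Re (zs (n + N1))))" for n
  have nonempty: "mset (zs (n + N1)) \<noteq> {#}" for n
    using zs(1)[of "n + N1"] by (auto simp: N1_def)
  have real_zs: "z = complex_of_real (Re z)" if "z \<in> set (zs (n + N1))" for z n
    using N0[of "n + N1"] that by (auto simp: N1_def complex_is_Real_iff complex_eq_iff)
  have len: "length (zs (n + N1)) = n + N1" for n by (rule zs(1)) (simp add: N1_def)
  have \<nu>: "real_distribution \<nu>" using det by (simp add: characterized_by_moments_def)
  have \<rho>: "real_distribution (\<rho> n)" for n
    unfolding \<rho>_def by (rule real_distribution_empirical_measure)
  have int_\<rho>: "(\<integral>x. f x \<partial>\<rho> n) = (\<Sum>z\<leftarrow>zs (n + N1). f (Re z)) / real (n + N1)"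
    if "f \<in> borel_measurable borel" for f :: "real \<Rightarrow> real" and n
    using integral_empirical_measure_list[OF _ that, of "map Re (zs (n + N1))"] nonempty[of n] len[of n]
    unfolding \<rho>_def by (simp add: o_def)
  have sum_list_of_real: "(\<Sum>z\<leftarrow>xs. complex_of_real (g z)) = complex_of_real (\<Sum>z\<leftarrow>xs. g z)"
    for xs :: "complex list" and g
    by (induction xs) simp_all
  have weak: "weak_conv_m \<rho> \<nu>"
  proof (rule method_of_moments[OF \<rho> _ _ det])
    show "integrable (\<rho> n) (\<lambda>x. x ^ l)" for n l
      using nonempty[of n] unfolding \<rho>_def by (intro integrable_empirical_measure) auto
    have "(\<integral>x. x ^ l \<partial>\<rho> n) = Re (\<Sum>z\<leftarrow>zs (n + N1). z ^ l) / real (n + N1)" for n l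
    proof -
      have "(\<Sum>z\<leftarrow>zs (n + N1). z ^ l) = (\<Sum>z\<leftarrow>zs (n + N1). complex_of_real (Re z ^ l))"
        by (intro arg_cong[where f=sum_list] map_cong refl) (metis of_real_power real_zs)
      also have "\<dots> = complex_of_real (\<Sum>z\<leftarrow>zs (n + N1). Re z ^ l)"
        by (rule sum_list_of_real)
      finally show ?thesis by (simp add: int_\<rho>)
    qed
    then show "(\<lambda>n. \<integral>x. x ^ l \<partial>\<rho> n) \<longlonglongrightarrow> (\<integral>x. x ^ l \<partial>\<nu>)" for l
      using LIMSEQ_ignore_initial_segment[OF lim, of l N1] by simp
  qed
  show ?thesis
    unfolding weakly_converges_def
  proof (intro allI impI, elim conjE)
    fix f :: "complex \<Rightarrow> real" assume f: "continuous_on UNIV f" and "bounded (range f)"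
    then obtain B where B: "\<And>z. norm (f z) \<le> B" by (auto simp: bounded_iff)
    have f_meas [measurable]: "f \<in> borel_measurable borel" by (rule borel_measurable_continuous_onI[OF f])
    have of_real_meas [measurable]: "complex_of_real \<in> borel_measurable borel"
      by (intro borel_measurable_continuous_onI continuous_intros)
    have \<nu>_sets: "borel_measurable \<nu> = borel_measurable borel"
      using \<nu> by (intro measurable_cong_sets) (auto simp: real_distribution.events_eq_borel)
    have "(\<lambda>n. \<integral>x. f (complex_of_real x) \<partial>\<rho> n) \<longlonglongrightarrow> (\<integral>x. f (complex_of_real x) \<partial>\<nu>)"
    proof (rule weak_conv_imp_integral_bdd_continuous_conv[OF \<rho> \<nu> weak])
      have "continuous_on UNIV (\<lambda>x. f (complex_of_real x))"
        by (rule continuous_on_compose2[OF f]) (auto intro: continuous_intros)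
      then show "isCont (\<lambda>x. f (complex_of_real x)) x" for x
        by (simp add: continuous_on_eq_continuous_within)
      show "norm (f (complex_of_real x)) \<le> B" for x by (rule B)
    qed
    moreover have "(\<integral>x. f (complex_of_real x) \<partial>\<rho> n) = (\<integral>z. f z \<partial>\<mu> (n + N1))" for n
    proof -
      have "(\<integral>z. f z \<partial>\<mu> (n + N1)) = (\<Sum>z\<leftarrow>zs (n + N1). f z) / real (n + N1)"
        using integral_empirical_measure_list[OF _ f_meas, of "zs (n + N1)"] zs(2)[of "n + N1"]
          nonempty[of n] len[of n] by (simp add: N1_def)
      also have "(\<Sum>z\<leftarrow>zs (n + N1). f z) = (\<Sum>z\<leftarrow>zs (n + N1). f (complex_of_real (Re z)))"
        by (intro arg_cong[where f=sum_list] map_cong refl) (metis real_zs)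
      finally show ?thesis by (simp add: int_\<rho>)
    qed
    moreover have "(\<integral>z. f z \<partial>distr \<nu> borel complex_of_real) = (\<integral>x. f (complex_of_real x) \<partial>\<nu>)"
      by (rule integral_distr) (simp_all add: \<nu>_sets)
    ultimately have "(\<lambda>n. \<integral>z. f z \<partial>\<mu> (n + N1)) \<longlonglongrightarrow> (\<integral>z. f z \<partial>distr \<nu> borel complex_of_real)"
      by simp
    then show "(\<lambda>n. \<integral>z. f z \<partial>\<mu> n) \<longlonglongrightarrow> (\<integral>z. f z \<partial>distr \<nu> borel complex_of_real)"
      by (rule LIMSEQ_offset)
  qed
qed

theorem corollary1p5:
  fixes M :: "nat \<Rightarrow> real measure"
    and P Q :: "nat \<Rightarrow> nat \<Rightarrow> real \<Rightarrow> real"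
    and \<epsilon> :: real
    and \<mu>s :: "real measure"
  assumes "\<forall>N\<ge>1. biorthogonal_ensemble N (M N) (P N) (Q N)"
    and "structural_assumption M P Q"
    and "\<epsilon> > 0"
    and "\<forall>n::nat. n \<ge> 1 \<longrightarrow>
           (\<lambda>N. Max ((\<lambda>(k, m). \<bar>L2_inner (M N) (\<lambda>x. x * P N k x) (Q N m)\<bar>) `
                  {(k, m). \<bar>real k / real N - 1\<bar> \<le> \<epsilon> \<and> \<bar>real m / real N - 1\<bar> \<le> \<epsilon>}))
             \<in> o(\<lambda>N. real N powr (1 / real n))"
    and "\<forall>\<^sub>F N in sequentially.
           \<forall>z. avg_char N (be_law N (M N) (P N) (Q N)) z = 0 \<longrightarrow> z \<in> \<real>"
    and "characterized_by_moments \<mu>s"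
    and "\<forall>l::nat. (\<lambda>N. \<integral>x. (\<integral>t. t ^ l \<partial>empirical_points N x) \<partial>be_law N (M N) (P N) (Q N))
           \<longlonglongrightarrow> (\<integral>t. t ^ l \<partial>\<mu>s)"
  shows "weakly_converges (\<lambda>N. zeros_distribution N (be_law N (M N) (P N) (Q N)))
           (distr \<mu>s borel complex_of_real)"
proof -
  let ?L = "\<lambda>N. be_law N (M N) (P N) (Q N)"
  note struct = assms(2)[unfolded structural_assumption_def]
  from struct obtain q :: "nat \<Rightarrow> nat"
    where q_all: "\<forall>n::nat. n \<ge> 1 \<longrightarrow> (\<lambda>N. real (q N)) \<in> o(\<lambda>N. real N powr (1 / real n))"
      and rec: "\<forall>N\<ge>1. \<forall>k. \<exists>c. AE x in M N. x * P N k x = (\<Sum>m\<le>k + q N. c m * P N m x)"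
    by (elim conjE exE) (rule that)
  have q: "(\<lambda>N. real (q N)) \<in> o(\<lambda>N. real N powr (1 / real n))" if "n \<ge> 1" for n :: nat
    using q_all that by simp
  have be: "biorthogonal_ensemble N (M N) (P N) (Q N)" if "N \<ge> 1" for N using assms(1) that by blast
  have sys: "banded_biorthogonal_system (M N) (P N) (Q N) (q N)" if "N \<ge> 1" for N
    using be[OF that] rec struct that
    by (simp add: banded_biorthogonal_system_def biorthogonal_ensemble_def)
  define J where "J N = banded_biorthogonal_system.mult_coeff (M N) (P N) (Q N)" for N
  have J: "J N k m = L2_inner (M N) (\<lambda>x. x * P N k x) (Q N m)" if "N \<ge> 1" for N k m
    unfolding J_def by (rule banded_biorthogonal_system.mult_coeff_def[OF sys[OF that]])
  define spectrum where "spectrum N es \<longleftrightarrow> length es = N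
      \<and> zeros_distribution N (?L N) = empirical_measure (mset es)
      \<and> (\<forall>e\<in>set es. avg_char N (?L N) e = 0)
      \<and> (\<forall>l. (\<Sum>e\<leftarrow>es. e ^ l) = complex_of_real (\<Sum>k<N. walk_sum (J N) {..<N} l k k))"
    for N and es :: "complex list"
  have "\<exists>es. spectrum N es" if "N \<ge> 1" for N
    by (rule banded_biorthogonal_system.zeros_of_avg_char[OF sys[OF that] be[OF that]])
       (auto simp: J_def spectrum_def)
  then have "spectrum N (SOME es. spectrum N es)" if "N \<ge> 1" for N
    using that by (blast intro: someI_ex)
  then obtain zs where spec: "\<And>N. N \<ge> 1 \<Longrightarrow> spectrum N (zs N)" by (rule that)
  have zs: "length (zs N) = N" "zeros_distribution N (?L N) = empirical_measure (mset (zs N))"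
    "e \<in> set (zs N) \<Longrightarrow> avg_char N (?L N) e = 0"
    "(\<Sum>e\<leftarrow>zs N. e ^ l) = complex_of_real (\<Sum>k<N. walk_sum (J N) {..<N} l k k)"
    if "N \<ge> 1" for N e l
    using spec[OF that] by (simp_all add: spectrum_def)
  show ?thesis
  proof (rule weakly_converges_of_moments[OF zs(1,2) _ assms(6)])
    show "\<forall>\<^sub>F N in sequentially. set (zs N) \<subseteq> \<real>"
      using assms(5) eventually_ge_at_top[of 1] by eventually_elim (use zs(3) in blast)
    fix l
    have "(\<lambda>N. (\<Sum>k<N. walk_sum (J N) {..N + l * q N} l k k) / real N
        - (\<Sum>k<N. walk_sum (J N) {..<N} l k k) / real N) \<longlonglongrightarrow> 0"
    proof (rule walk_sum_difference_negligible[OF _ q assms(3)])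
      show "J N k m = 0" if "N \<ge> 1" "k + q N < m" for N k m
        unfolding J_def by (rule banded_biorthogonal_system.mult_coeff_eq_0[OF sys]) (use that in auto)
      show "(\<lambda>N. Max ((\<lambda>(k, m). \<bar>J N k m\<bar>) `
          {(k, m). \<bar>real k / real N - 1\<bar> \<le> \<epsilon> \<and> \<bar>real m / real N - 1\<bar> \<le> \<epsilon>}))
          \<in> o(\<lambda>N. real N powr (1 / real n))" if "n \<ge> 1" for n
      proof (rule landau_o.small.in_cong[THEN iffD1])
        show "(\<lambda>N. Max ((\<lambda>(k, m). \<bar>L2_inner (M N) (\<lambda>x. x * P N k x) (Q N m)\<bar>) `
            {(k, m). \<bar>real k / real N - 1\<bar> \<le> \<epsilon> \<and> \<bar>real m / real N - 1\<bar> \<le> \<epsilon>}))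
            \<in> o(\<lambda>N. real N powr (1 / real n))"
          using assms(4) that by blast
      qed (use eventually_ge_at_top[of 1] in \<open>eventually_elim, simp add: J\<close>)
    qed
    moreover have "(\<lambda>N. (\<Sum>k<N. walk_sum (J N) {..N + l * q N} l k k) / real N) \<longlonglongrightarrow> (\<integral>t. t ^ l \<partial>\<mu>s)"
    proof (rule Lim_transform_eventually[OF assms(7)[rule_format, of l]])
      show "\<forall>\<^sub>F N in sequentially. (\<integral>x. (\<integral>t. t ^ l \<partial>empirical_points N x) \<partial>?L N)
          = (\<Sum>k<N. walk_sum (J N) {..N + l * q N} l k k) / real N"
        using eventually_ge_at_top[of 1]
        by eventually_elim
          (simp add: J_def banded_biorthogonal_system.expected_empirical_moment[OF sys be])
    qed
    ultimately have "(\<lambda>N. (\<Sum>k<N. walk_sum (J N) {..<N} l k k) / real N) \<longlonglongrightarrow> (\<integral>t. t ^ l \<partial>\<mu>s) - 0"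
      using tendsto_diff by fastforce
    then have lim: "(\<lambda>N. (\<Sum>k<N. walk_sum (J N) {..<N} l k k) / real N) \<longlonglongrightarrow> (\<integral>t. t ^ l \<partial>\<mu>s)"
      by simp
    show "(\<lambda>N. Re (\<Sum>z\<leftarrow>zs N. z ^ l) / real N) \<longlonglongrightarrow> (\<integral>t. t ^ l \<partial>\<mu>s)"
    proof (rule Lim_transform_eventually[OF lim])
      show "\<forall>\<^sub>F N in sequentially. (\<Sum>k<N. walk_sum (J N) {..<N} l k k) / real N
          = Re (\<Sum>z\<leftarrow>zs N. z ^ l) / real N"
        using eventually_ge_at_top[of 1] by eventually_elim (simp add: zs(4))
    qed
  qed
qed

end
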